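(* Let $V$ be a finite subset of $\mathbb{Z}_{>0}$. For all $\pi\in\Pi_{\Gamma_V}$, we have that $(-1)^{|\pi|}\mu_{\Pi_{\Gamma_V}}(\hat0,\pi)$ equals the number of ID forests on $V$ whose trees have node sets equal to the blocks of $\pi$. Consequently, $-\mu_{\Pi_{\Gamma_V}}(\hat0,\hat1)$ is equal to the number of ID trees on $V$, and $$\chi_{\Pi_{\Gamma_V}}(t)=\sum_{k=1}^{|V|}(-1)^{k}\,|\mathcal{F}_{V,k}|\,t^{k-1},$$ where $\mathcal{F}_{V,k}$ is the set of ID forests on $V$ with exactly $k$ trees.
   Context: For a finite set $V\subset\mathbb{Z}_{>0}$, $\Gamma_V$ is the bipartite graph on vertex set $V$ with an edge $\{u,v\}$ for each $u<v$ in $V$ with $u$ odd and $v$ even. For a finite graph $G$ with vertex set $V$, the bond lattice $\Pi_G$ is the set of partitions $\pi$ of $V$ such that the induced subgraph of $G$ on each block is connected, ordered by: $\pi\le\pi'$ iff every block of $\pi$ is contained in a block of $\pi'$. Its minimum $\hat0$ is the partition into singletons, $\hat1$ is its maximum, and $|\pi|$ denotes the number of blocks of $\pi$. For a finite ranked poset $P$ of length $\ell$ with minimum $\hat0$, Möbius function $\mu_P$ and rank function $\mathrm{rk}$, the characteristic polynomial is $\chi_P(t)=\sum_{x\in P}\mu_P(\hat0,x)t^{\ell-\mathrm{rk}(x)}$. A tree $T$ with nodes in $\mathbb{Z}_{>0}$ is increasing-decreasing (ID) if, when $T$ is rooted at its largest node, each internal (i.e. non-leaf, having at least one child) node $v$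 satisfies: (1) if $v$ is odd then $v$ is less than all its descendants and all its children are even; (2) if $v$ is even then $v$ is greater than all its descendants and all its children are odd. (A single-node tree is an ID tree.) An ID forest on $V$ is a forest with node set $V$ each of whose components is an ID tree.
   Formalization: All three formulas carry an extra factor (-1)^{|V|} (as printed they fail for odd |V|, e.g. V={1}); the two consequences (ID trees and characteristic polynomial) assume Γ_V connected and V nonempty, since they fail otherwise, e.g. V={1,3}. *)

theory Defs
  imports
    "HOL-Library.Disjoint_Sets"
    "HOL-Computational_Algebra.Polynomial"
    "Graph_Theory.Graph_Theory"
begin

section \<open>Finite posets\<close>

text \<open>A poset is given by its order relation \<open>r\<close>; its carrier is \<open>Field r\<close>.\<close>

definition poset_bot :: "'a rel \<Rightarrow> 'a" where
  "poset_bot r = (THE x. x \<in> Field r \<and> (\<forall>y \<in> Field r. (x, y) \<in> r))"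

definition poset_top :: "'a rel \<Rightarrow> 'a" where
  "poset_top r = (THE x. x \<in> Field r \<and> (\<forall>y \<in> Field r. (y, x) \<in> r))"

text \<open>The side conditions on \<open>r\<close> only serve to make the recursion terminate
  for every argument.\<close>

function moebius :: "'a rel \<Rightarrow> 'a \<Rightarrow> 'a \<Rightarrow> int" where
  "moebius r x y =
     (if finite (Field r) \<and> Partial_order r \<and> (x, y) \<in> r
      then if x = y then 1 else - (\<Sum>z \<in> {z \<in> underS r y. (x, z) \<in> r}. moebius r x z)
      else 0)"
  by pat_completeness auto
termination
proof (relation "measure (\<lambda>(r, x, y). card (underS r y))", goal_cases)
  case 1
  show ?case by simp
next
  case (2 r x y z)
  then have fin: "finite (Field r)" and po: "Partial_order r"
    and zy: "z \<noteq> y" "(z, y) \<in> r"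
    by (auto simp: underS_def)
  have tr: "trans r" and an: "antisym r"
    using po by (auto simp: partial_order_on_def preorder_on_def)
  have "underS r z \<subseteq> underS r y"
    using zy transD[OF tr] antisymD[OF an] by (auto simp: underS_def)
  moreover have "z \<in> underS r y" "z \<notin> underS r z"
    using zy by (auto simp: underS_def)
  ultimately have "underS r z \<subset> underS r y" by blast
  moreover have "finite (underS r y)"
    by (rule finite_subset[OF _ fin]) (auto simp: underS_def Field_def)
  ultimately show ?case by (simp add: psubset_card_mono)
qed

declare moebius.simps [simp del]

text \<open>The length of a finite poset is the length (number of elements minus one) of a longest
  chain. On a ranked poset the rank function maps \<open>x\<close> to the length of the principal
  ideal of \<open>x\<close>.\<close>

definition poset_length :: "'a rel \<Rightarrow> nat" where
  "poset_length r = Max ((\<lambda>C. card C - 1) ` Chains r)"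

definition poset_rank :: "'a rel \<Rightarrow> 'a \<Rightarrow> nat" where
  "poset_rank r x = poset_length (Restr r (under r x))"

definition characteristic_poly :: "'a rel \<Rightarrow> int poly" where
  "characteristic_poly r =
     (\<Sum>x \<in> Field r. monom (moebius r (poset_bot r) x) (poset_length r - poset_rank r x))"


section \<open>Graphs and bond lattices\<close>

text \<open>Finite simple graphs are symmetric loop-free finite digraphs (\<^locale>\<open>pair_graph\<close>): an
  edge between \<open>u\<close> and \<open>v\<close> is the pair of arcs \<open>(u, v)\<close>, \<open>(v, u)\<close>.\<close>

definition Gamma :: "nat set \<Rightarrow> nat pair_pre_digraph" where
  "Gamma V = \<lparr> pverts = V,
     parcs = {(u, v) \<in> V \<times> V. (u < v \<and> odd u \<and> even v) \<or> (v < u \<and> odd v \<and> even u)} \<rparr>"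

definition bonds :: "'a pair_pre_digraph \<Rightarrow> 'a set set set" where
  "bonds G = {\<pi>. partition_on (pverts G) \<pi> \<and>
     (\<forall>B \<in> \<pi>. Digraph_Component.connected (with_proj G \<restriction> B))}"

definition bond_lattice :: "'a pair_pre_digraph \<Rightarrow> 'a set set rel" where
  "bond_lattice G = relation_of (refines (pverts G)) (bonds G)"


section \<open>ID trees and ID forests\<close>

text \<open>In a symmetric digraph, walking along an edge and back is a closed walk of length two that
  counts as a cycle for \<^const>\<open>pre_digraph.cycle\<close> (so \<^const>\<open>Digraph_Component.forest\<close> and
  \<^const>\<open>Digraph_Component.tree\<close> do not describe undirected forests and trees). The cycles of
  the underlying simple graph are those of length at least three.\<close>

definition undirected_forest :: "('a, 'b) pre_digraph \<Rightarrow> bool" where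
  "undirected_forest G \<longleftrightarrow> graph G \<and> \<not> (\<exists>p. pre_digraph.cycle G p \<and> 3 \<le> length p)"

definition undirected_tree :: "('a, 'b) pre_digraph \<Rightarrow> bool" where
  "undirected_tree G \<longleftrightarrow> undirected_forest G \<and> Digraph_Component.connected G"

text \<open>Descendants and children of \<open>v\<close> in the tree \<open>T\<close> rooted at \<open>r\<close>: the nodes \<open>w \<noteq> v\<close> for
  which \<open>v\<close> lies on the path from \<open>r\<close> to \<open>w\<close>, and those among them adjacent to \<open>v\<close>.\<close>

definition descendant :: "('a, 'b) pre_digraph \<Rightarrow> 'a \<Rightarrow> 'a \<Rightarrow> 'a \<Rightarrow> bool" where
  "descendant T r v w \<longleftrightarrow>
     w \<noteq> v \<and> (\<exists>p. pre_digraph.apath T r p w \<and> v \<in> set (pre_digraph.awalk_verts T r p))"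

definition child :: "('a, 'b) pre_digraph \<Rightarrow> 'a \<Rightarrow> 'a \<Rightarrow> 'a \<Rightarrow> bool" where
  "child T r v w \<longleftrightarrow> descendant T r v w \<and> v \<rightarrow>\<^bsub>T\<^esub> w"

definition ID_tree :: "(nat, 'b) pre_digraph \<Rightarrow> bool" where
  "ID_tree T \<longleftrightarrow> undirected_tree T \<and> 0 \<notin> verts T \<and>
     (let r = Max (verts T) in
      \<forall>v \<in> verts T. (\<exists>w. child T r v w) \<longrightarrow>
        (odd v \<longrightarrow> (\<forall>w. descendant T r v w \<longrightarrow> v < w) \<and> (\<forall>w. child T r v w \<longrightarrow> even w)) \<and>
        (even v \<longrightarrow> (\<forall>w. descendant T r v w \<longrightarrow> w < v) \<and> (\<forall>w. child T r v w \<longrightarrow> odd w)))"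

definition ID_trees :: "nat set \<Rightarrow> nat pair_pre_digraph set" where
  "ID_trees V = {T. pverts T = V \<and> ID_tree (with_proj T)}"

text \<open>In a symmetric digraph, the connected components are the strongly connected ones.\<close>

definition components_of :: "'a pair_pre_digraph \<Rightarrow> ('a, 'a \<times> 'a) pre_digraph set" where
  "components_of F = pre_digraph.sccs (with_proj F)"

definition ID_forests :: "nat set \<Rightarrow> nat pair_pre_digraph set" where
  "ID_forests V = {F. pverts F = V \<and> undirected_forest (with_proj F) \<and>
     (\<forall>T \<in> components_of F. ID_tree T)}"

definition ID_forests_card :: "nat set \<Rightarrow> nat \<Rightarrow> nat pair_pre_digraph set" where
  "ID_forests_card V k = {F \<in> ID_forests V. card (components_of F) = k}"

end

theory Submission
  imports Defs
begin

text \<open>An ID forest is the same as a subgraph \<open>F\<close> of \<open>\<Gamma>\<^sub>V\<close> that contains no path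
  \<open>v', u, v, u'\<close> with \<open>u\<close>, \<open>u'\<close> odd, \<open>u' < u\<close> and \<open>v < v'\<close> (a 4-cycle of \<open>\<Gamma>\<^sub>V\<close> with the edge
  \<open>u'v'\<close> missing). Indeed, along a non-backtracking walk in such an \<open>F\<close> that starts at a maximal
  vertex, the odd vertices increase and the even ones decrease. This excludes cycles
  and gives the ID condition.

  For a bond \<open>\<pi>\<close> with a block \<open>B\<close> of size at least two, \<open>m = min B\<close> is odd and
  \<open>M = max B\<close> is even. Toggling the edge \<open>mM\<close> preserves the path condition and changes the number
  of trees by one, since \<open>m\<close> and \<open>M\<close> can only be connected in \<open>F\<close> by the edge \<open>mM\<close>. Hence the
  signed count of the ID forests refining \<open>\<pi>\<close> vanishes, which is the recursion for the Moebius
  function.\<close>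

section \<open>ID forests as subgraphs without broken circuits\<close>

lemma parcs_Gamma:
  "(u, v) \<in> parcs (Gamma V) \<longleftrightarrow>
     u \<in> V \<and> v \<in> V \<and> (u < v \<and> odd u \<and> even v \<or> v < u \<and> odd v \<and> even u)"
  by (auto simp: Gamma_def)

lemma pverts_Gamma [simp]: "pverts (Gamma V) = V"
  by (simp add: Gamma_def)

text \<open>The name stands for ``no broken circuit''.\<close>

definition nbc :: "nat set \<Rightarrow> nat pair_pre_digraph \<Rightarrow> bool" where
  "nbc V F \<longleftrightarrow> pverts F = V \<and> sym (parcs F) \<and> parcs F \<subseteq> parcs (Gamma V) \<and>
     (\<forall>u v u' v'. odd u \<and> u' < u \<and> v < v' \<and> (u, v') \<in> parcs F \<and> (u, v) \<in> parcs F \<longrightarrow>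
        (u', v) \<notin> parcs F)"

text \<open>The side of \<open>a\<close> on which the ID condition puts the descendants of \<open>a\<close>.\<close>

definition beyond :: "nat \<Rightarrow> nat \<Rightarrow> bool" where
  "beyond a b \<longleftrightarrow> (if even a then b < a else a < b)"

section \<open>Monotone non-backtracking walks and acyclicity\<close>

locale nbc_graph =
  fixes V :: "nat set" and F :: "nat pair_pre_digraph"
  assumes finite_V: "finite V" and nbc: "nbc V F"
begin

lemma verts_eq [simp]: "pverts F = V"
  and arc_sym: "(a, b) \<in> parcs F \<Longrightarrow> (b, a) \<in> parcs F"
  and arc_Gamma: "(a, b) \<in> parcs F \<Longrightarrow> (a, b) \<in> parcs (Gamma V)"
  using nbc unfolding nbc_def by (blast dest: symD)+

lemma no_pattern:
  "\<lbrakk>odd u; u' < u; v < v'; (u, v') \<in> parcs F; (u, v) \<in> parcs F\<rbrakk> \<Longrightarrow> (u', v) \<notin> parcs F"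
  using nbc unfolding nbc_def by blast

lemma arc_beyond: "(a, b) \<in> parcs F \<Longrightarrow> beyond a b"
  using arc_Gamma by (fastforce simp: parcs_Gamma beyond_def)

lemma arc_parity: "(a, b) \<in> parcs F \<Longrightarrow> odd a \<longleftrightarrow> even b"
  using arc_Gamma by (fastforce simp: parcs_Gamma)

sublocale pair_graph F
proof
  show "finite (parcs F)"
    using nbc finite_V
    by (auto simp: nbc_def Gamma_def intro!: finite_subset[of "parcs F" "V \<times> V"])
  show "symmetric (with_proj F)"
    by (auto simp: symmetric_def intro!: symI arc_sym)
  show "fst e \<noteq> snd e" if "e \<in> parcs F" for e
    using arc_Gamma[of "fst e" "snd e"] that by (cases e) (auto simp: parcs_Gamma)
qed (use finite_V in \<open>auto simp: parcs_Gamma dest!: arc_Gamma\<close>)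

text \<open>If \<open>b\<close> and \<open>d\<close> were in the wrong order, the walk
  \<open>a, b, c, d\<close>, read forwards for even \<open>a\<close> and backwards for odd
  \<open>a\<close>, would be the path excluded by \<open>nbc\<close>.\<close>

lemma beyond_step:
  assumes "(a, b) \<in> parcs F" "(b, c) \<in> parcs F" "(c, d) \<in> parcs F" "b \<noteq> d" "beyond a c"
  shows "beyond b d"
proof (cases "even a")
  case True
  then have "odd b" "even c" "odd d" using assms arc_parity by blast+
  then show ?thesis
    using assms no_pattern[of b d c a] True arc_sym by (force simp: beyond_def)
next
  case False
  then have "even b" "odd c" "even d" using assms arc_parity by blast+
  then show ?thesis
    using assms no_pattern[of c a b d] False arc_sym by (force simp: beyond_def)
qed

text \<open>\<open>beyond_step\<close> carries the start condition along the walk, so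
  \<open>beyond\<close> holds between any vertices two steps apart. Such vertices have equal parity,
  hence these relations compose; a final arc accounts for odd distances.\<close>

lemma zigzag:
  fixes x :: "nat \<Rightarrow> nat"
  assumes arcs: "\<And>i. i < n \<Longrightarrow> (x i, x (Suc i)) \<in> parcs F"
    and nonback: "\<And>i. Suc i < n \<Longrightarrow> x i \<noteq> x (Suc (Suc i))"
    and start: "2 \<le> n \<Longrightarrow> beyond (x 0) (x 2)"
    and ij: "i < j" "j \<le> n"
  shows "beyond (x i) (x j)"
proof -
  have two: "beyond (x i) (x (Suc (Suc i)))" if "Suc i < n" for i
    using that
  proof (induction i)
    case 0
    then show ?case using start by (simp add: numeral_2_eq_2)
  next
    case (Suc i)
    then show ?case
      using beyond_step[of "x i" "x (Suc i)" "x (Suc (Suc i))" "x (Suc (Suc (Suc i)))"] arcs nonback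
      by simp
  qed
  show ?thesis using ij
  proof (induction "j - i" arbitrary: i rule: less_induct)
    case less
    consider "j = Suc i" | "j = Suc (Suc i)" | "Suc (Suc i) < j"
      using less.prems by linarith
    then show ?case
    proof cases
      case 3
      then have "beyond (x (Suc (Suc i))) (x j)" using less by simp
      moreover have "beyond (x i) (x (Suc (Suc i)))" using 3 less.prems two by simp
      moreover have "even (x i) \<longleftrightarrow> even (x (Suc (Suc i)))"
        using 3 less.prems arc_parity[OF arcs[of i]] arc_parity[OF arcs[of "Suc i"]] by auto
      ultimately show ?thesis by (auto simp: beyond_def split: if_splits)
    qed (use less.prems two arc_beyond arcs in auto)
  qed
qed

end

lemma (in pair_wf_digraph) awalk_nth:
  assumes "awalk u p v"
  shows "awalk_verts u p ! 0 = u" "awalk_verts u p ! length p = v"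
    "i < length p \<Longrightarrow> (awalk_verts u p ! i, awalk_verts u p ! Suc i) \<in> parcs G"
  using assms
proof (induction p arbitrary: u i)
  case Nil
  { case 1 then show ?case by simp }
  { case 2 then show ?case by (simp add: awalk_Nil_iff) }
  { case 3 then show ?case by simp }
next
  case (Cons e p)
  { case 1 then show ?case by (simp add: awalk_Cons_iff) }
  { case 2 then show ?case using Cons.IH by (simp add: awalk_Cons_iff) }
  { case 3
    then show ?case using Cons.IH by (cases i) (auto simp: awalk_Cons_iff) }
qed

context nbc_graph
begin

text \<open>A path does not return to the maximum \<open>r\<close>, so its third vertex lies
  strictly below \<open>r\<close>. As \<open>r\<close> is even, this is the start condition of
  \<open>zigzag\<close>.\<close>

lemma apath_zigzag:
  assumes p: "apath r p w" and r: "\<And>y. r \<rightarrow>\<^sup>*\<^bsub>F\<^esub> y \<Longrightarrow> y \<le> r" and "length p > 1 \<Longrightarrow> even r"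
    and ij: "i < j" "j \<le> length p"
  shows "beyond (awalk_verts r p ! i) (awalk_verts r p ! j)"
proof -
  let ?xs = "awalk_verts r p"
  have w: "awalk r p w" and d: "distinct ?xs" using p by (auto simp: apath_def)
  have len: "length ?xs = Suc (length p)" by (rule length_awalk_verts)
  have "beyond (?xs ! 0) (?xs ! 2)" if "2 \<le> length p"
  proof -
    have "?xs ! 2 \<in> set ?xs" using that len by (intro nth_mem) simp
    then have "?xs ! 2 \<le> r" using awalk_verts_reachable_from[OF w] r by blast
    moreover have "?xs ! 2 \<noteq> ?xs ! 0" using that len d by (simp add: nth_eq_iff_index_eq)
    ultimately show ?thesis using assms(3) that awalk_nth(1)[OF w] by (simp add: beyond_def)
  qed
  then show ?thesis
    using zigzag[of "length p" "\<lambda>i. ?xs ! i" i j] awalk_nth(3)[OF w] ij d len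
    by (simp add: nth_eq_iff_index_eq)
qed

text \<open>Run once around the cycle from its largest vertex. That vertex is even because its
  successor is smaller, so \<open>zigzag\<close> can start there and would put the vertex strictly
  below itself.\<close>

lemma no_cycle:
  assumes "cycle p" shows "length p < 3"
proof (rule ccontr)
  assume "\<not> length p < 3"
  obtain u where w: "awalk u p u" and d: "distinct (tl (awalk_verts u p))"
    using assms by (auto simp: cycle_def)
  define k xs where "k = length p" and "xs = awalk_verts u p"
  have k: "3 \<le> k" using \<open>\<not> length p < 3\<close> by (simp add: k_def)
  have len: "length xs = Suc k" unfolding k_def xs_def by (rule length_awalk_verts)
  have ends: "xs ! k = xs ! 0" using awalk_nth(1,2)[OF w] by (simp add: k_def xs_def)
  \<comment> \<open>The periodic unrolling allows a start at any vertex. Since \<open>xs\<close>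
    ends where it begins, \<open>tl xs\<close> lists each vertex of the cycle once.\<close>
  define y where "y i = tl xs ! (i mod k)" for i
  have ntl: "tl xs ! i = xs ! Suc i" if "i < k" for i using that len by (simp add: nth_tl)
  have arc: "(y i, y (Suc i)) \<in> parcs F" for i
  proof (cases "Suc (i mod k) = k")
    case True
    then have "y (Suc i) = xs ! 1" "y i = xs ! 0"
      using k ntl ends by (auto simp: y_def mod_Suc)
    moreover have "0 < length p" using k k_def by linarith
    ultimately show ?thesis using awalk_nth(3)[OF w, of 0] by (simp add: xs_def)
  next
    case False
    then have "Suc (i mod k) < k" using k by (simp add: Suc_lessI)
    then show ?thesis using awalk_nth(3)[OF w, of "Suc (i mod k)"] k ntl
      by (auto simp: y_def mod_Suc k_def xs_def)
  qed
  have nb: "y i \<noteq> y (Suc (Suc i))" for i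
  proof -
    \<comment> \<open>Indices differing by 2 are distinct modulo \<open>k\<close> because
      \<open>k\<close> is at least 3, and \<open>tl xs\<close> has no repetitions.\<close>
    have "i mod k \<noteq> Suc (Suc i) mod k" using k by (auto simp: mod_Suc)
    then show ?thesis using d k len by (simp add: y_def nth_eq_iff_index_eq xs_def)
  qed
  have "finite (range y)"
    by (rule finite_subset[of _ "set (tl xs)"]) (use k len in \<open>auto simp: y_def\<close>)
  then obtain a where a: "y a = Max (range y)" by (metis Max_in empty_not_UNIV image_is_empty rangeE)
  have top: "y i \<le> y a" for i unfolding a using \<open>finite (range y)\<close> by simp
  have "even (y a)" using arc_beyond[OF arc[of a]] top[of "Suc a"] by (auto simp: beyond_def split: if_splits)
  then have "beyond (y a) (y (Suc (Suc a)))"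
    using top[of "Suc (Suc a)"] nb[of a] by (auto simp: beyond_def)
  then have "beyond (y (a + 0)) (y (a + k))"
    using zigzag[of k "\<lambda>i. y (a + i)" 0 k] arc nb k by simp
  then show False by (auto simp: y_def beyond_def split: if_splits)
qed

lemma undirected_forest: "undirected_forest (with_proj F)"
  unfolding undirected_forest_def using no_cycle pair_graphD_graph by fastforce

end

section \<open>Paths from the root of a forest\<close>

lemma (in graph) last_arc:
  assumes forest: "\<And>c. cycle c \<Longrightarrow> length c < 3"
    and p: "apath r p u" and v: "v \<in> set (awalk_verts r p)" and uv: "u \<rightarrow>\<^bsub>G\<^esub> v"
  shows "p \<noteq> [] \<and> tail G (last p) = v"
proof -
  obtain e where e: "e \<in> arcs G" "tail G e = u" "head G e = v" using uv by auto
  have "u \<noteq> v" using uv adj_not_same by auto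
  obtain q s where qs: "p = q @ s" "awalk r q v" "awalk v s u"
    using awalk_decomp[OF awalkI_apath[OF p] v] by blast
  have "apath v s u" using p qs by (auto simp: apath_append_iff)
  then have d: "distinct (awalk_verts v s)" by (simp add: apath_def)
  have s: "s \<noteq> []" using qs(3) \<open>u \<noteq> v\<close> by (auto simp: awalk_Nil_iff)
  \<comment> \<open>Closing the part of \<open>p\<close> from \<open>v\<close> to \<open>u\<close>
    by the arc \<open>e\<close> gives a cycle. In a forest its length is two, so that part of
    \<open>p\<close> is a single arc.\<close>
  have w: "awalk v (s @ [e]) v" using qs(3) e by (auto simp: awalk_simps)
  moreover have "awalk_verts v (s @ [e]) = awalk_verts v s @ [v]"
    using e awalk_verts_append[OF w] by simp
  moreover have "distinct (tl (awalk_verts v s) @ [v])"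
    using d s qs(3) by (cases s) (auto simp: awalk_Cons_iff)
  ultimately have "cycle (s @ [e])" by (auto simp: cycle_def intro!: exI[of _ v])
  then have "length s = 1" using forest[of "s @ [e]"] s by (cases s) auto
  then obtain f where "s = [f]" by (auto simp: length_Suc_conv)
  then show ?thesis using qs by (auto simp: awalk_simps)
qed

lemma (in wf_digraph) apath_snoc:
  assumes "apath r p (tail G e)" "e \<in> arcs G" "head G e \<notin> set (awalk_verts r p)"
  shows "apath r (p @ [e]) (head G e)" "awalk_verts r (p @ [e]) = awalk_verts r p @ [head G e]"
proof -
  have "awalk r (p @ [e]) (head G e)"
    using assms by (auto simp: apath_def awalk_simps)
  from awalk_verts_append[OF this] show v: "awalk_verts r (p @ [e]) = awalk_verts r p @ [head G e]"
    by simp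
  show "apath r (p @ [e]) (head G e)"
    using \<open>awalk _ _ _\<close> assms unfolding apath_def v by simp
qed

text \<open>If \<open>v\<close> is not on \<open>p\<close>, appending the arc gives a path to
  \<open>v\<close> through \<open>u\<close>. This decides which end of an edge is the
  parent.\<close>

lemma (in wf_digraph) rooted_arc:
  assumes p: "apath r p u" and uv: "u \<rightarrow>\<^bsub>G\<^esub> v"
  shows "v \<in> set (awalk_verts r p) \<or> (\<exists>q. apath r q v \<and> u \<in> set (awalk_verts r q))"
proof (rule disjCI)
  assume nex: "\<nexists>q. apath r q v \<and> u \<in> set (awalk_verts r q)"
  obtain e where e: "e \<in> arcs G" "tail G e = u" "head G e = v" using uv by auto
  show "v \<in> set (awalk_verts r p)"
  proof (rule ccontr)
    assume "v \<notin> set (awalk_verts r p)"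
    then have "apath r (p @ [e]) v" using apath_snoc[of r p e] p e by simp
    moreover have "u \<in> set (awalk_verts r (p @ [e]))"
      using e awalk_verts_arc1[of e "p @ [e]"] by simp
    ultimately show False using nex by blast
  qed
qed

text \<open>By \<open>last_arc\<close>, the only neighbour of \<open>v\<close> on \<open>p\<close>
  is its predecessor \<open>u\<close>, so \<open>p\<close> extends to \<open>x\<close>. This brings
  grandchildren of \<open>u\<close> under the ID condition at \<open>u\<close>.\<close>

lemma (in graph) rooted_branch:
  assumes forest: "\<And>c. cycle c \<Longrightarrow> length c < 3"
    and p: "apath r p v" and u: "u \<in> set (awalk_verts r p)" and uv: "u \<rightarrow>\<^bsub>G\<^esub> v"
    and vx: "v \<rightarrow>\<^bsub>G\<^esub> x" and "x \<noteq> u"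
  shows "descendant G r u x"
proof -
  have "v \<rightarrow>\<^bsub>G\<^esub> u" using uv graph_symmetric by blast
  then have "x \<notin> set (awalk_verts r p)"
    using last_arc[OF forest p u] last_arc[OF forest p _ vx] \<open>x \<noteq> u\<close> by blast
  moreover obtain e where e: "e \<in> arcs G" "tail G e = v" "head G e = x" using vx by auto
  ultimately have "apath r (p @ [e]) x" "u \<in> set (awalk_verts r (p @ [e]))"
    using apath_snoc[of r p e] p u by auto
  then show ?thesis using \<open>x \<noteq> u\<close> by (auto simp: descendant_def)
qed

section \<open>ID trees avoid the excluded path\<close>

locale ID_tree_graph = graph G for G :: "(nat, 'b) pre_digraph" +
  assumes ID: "ID_tree G"
begin

definition root :: nat where "root = Max (verts G)"

lemma forest: "cycle c \<Longrightarrow> length c < 3"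
  using ID by (auto simp: ID_tree_def undirected_tree_def undirected_forest_def not_le)

lemma root_apath:
  assumes "u \<in> verts G"
  obtains p where "apath root p u"
proof -
  have "strongly_connected G"
    using ID by (intro symmetric_connected_imp_strongly_connected)
      (auto simp: ID_tree_def undirected_tree_def)
  moreover have "root \<in> verts G" using assms by (auto simp: root_def intro: Max_in)
  ultimately have "root \<rightarrow>\<^sup>*\<^bsub>G\<^esub> u" using assms by blast
  then show ?thesis using that by (auto simp: reachable_apath)
qed

lemma arc_cases:
  assumes "u \<rightarrow>\<^bsub>G\<^esub> v"
  obtains p where "apath root p v" "u \<in> set (awalk_verts root p)"
  | p where "apath root p u" "v \<in> set (awalk_verts root p)"
  using assms root_apath[of u] rooted_arc[of root _ u v] by (metis adj_in_verts(1))

lemma child_of_apath: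
  assumes "apath root p v" "u \<in> set (awalk_verts root p)" "u \<rightarrow>\<^bsub>G\<^esub> v"
  shows "child G root u v"
  using assms adj_not_same by (auto simp: child_def descendant_def)

lemma internal:
  assumes "child G root u v"
  shows "odd u \<Longrightarrow> descendant G root u w \<Longrightarrow> u < w" "odd u \<Longrightarrow> child G root u w \<Longrightarrow> even w"
    "even u \<Longrightarrow> descendant G root u w \<Longrightarrow> w < u" "even u \<Longrightarrow> child G root u w \<Longrightarrow> odd w"
proof -
  have "u \<in> verts G" using assms adj_in_verts by (auto simp: child_def)
  then show "odd u \<Longrightarrow> descendant G root u w \<Longrightarrow> u < w" "odd u \<Longrightarrow> child G root u w \<Longrightarrow> even w"
    "even u \<Longrightarrow> descendant G root u w \<Longrightarrow> w < u" "even u \<Longrightarrow> child G root u w \<Longrightarrow> odd w"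
    using assms ID unfolding ID_tree_def Let_def root_def by blast+
qed

lemma child_order:
  assumes "child G root u v"
  shows "u < v \<and> odd u \<and> even v \<or> v < u \<and> odd v \<and> even u"
  using assms internal[OF assms, of v] by (cases "even u") (auto simp: child_def)

lemma arc_order:
  assumes "u \<rightarrow>\<^bsub>G\<^esub> v"
  shows "u < v \<and> odd u \<and> even v \<or> v < u \<and> odd v \<and> even u"
proof -
  have "v \<rightarrow>\<^bsub>G\<^esub> u" using assms graph_symmetric by blast
  with assms show ?thesis
    by (rule_tac arc_cases[OF assms]) (use child_of_apath child_order in blast)+
qed

text \<open>Consider the path \<open>v', u, v, u'\<close>. If \<open>u\<close> is the parent of
  \<open>v\<close>, then \<open>u'\<close> is a descendant of the odd node \<open>u\<close> and
  smaller than it. If \<open>v\<close> is the parent of \<open>u\<close>, then \<open>v'\<close> is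
  a descendant of the even node \<open>v\<close> and larger than it. Both contradict the ID
  condition.\<close>

lemma no_pattern:
  assumes "odd u" "u' < u" "v < v'" "u \<rightarrow>\<^bsub>G\<^esub> v'" "u \<rightarrow>\<^bsub>G\<^esub> v"
  shows "\<not> u' \<rightarrow>\<^bsub>G\<^esub> v"
proof
  assume "u' \<rightarrow>\<^bsub>G\<^esub> v"
  then have vu': "v \<rightarrow>\<^bsub>G\<^esub> u'" and vu: "v \<rightarrow>\<^bsub>G\<^esub> u" using assms graph_symmetric by blast+
  have "even v" using arc_order[OF assms(5)] assms(1) by auto
  show False
    using assms(5)
  proof (cases rule: arc_cases)
    case (1 p)
    have "descendant G root u u'"
      using rooted_branch[OF forest 1 assms(5) vu'] assms(2) by simp
    then show False using internal(1)[OF child_of_apath[OF 1 assms(5)] assms(1)] assms(2) by force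
  next
    case (2 p)
    have "descendant G root v v'"
      using rooted_branch[OF forest 2 vu assms(4)] assms(3) by simp
    then show False using internal(3)[OF child_of_apath[OF 2 vu] \<open>even v\<close>] assms(3) by force
  qed
qed

end

section \<open>ID forests coincide with \<open>nbc\<close> graphs\<close>

lemma components_of_eq:
  assumes "pair_graph F"
  shows "verts ` components_of F = (\<lambda>x. (parcs F)\<^sup>* `` {x}) ` pverts F"
    "card (components_of F) = card (verts ` components_of F)"
proof -
  interpret pair_graph F by fact
  have "(x \<rightarrow>\<^sup>*\<^bsub>F\<^esub> y) \<longleftrightarrow> (x, y) \<in> (parcs F)\<^sup>*" if "x \<in> pverts F" for x y
  proof
    assume "(x, y) \<in> (parcs F)\<^sup>*"
    then show "x \<rightarrow>\<^sup>*\<^bsub>F\<^esub> y"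
      by (induction) (use that in \<open>auto intro: reachable_adj_trans\<close>)
  qed (auto dest: reachable_rtranclI)
  moreover have "scc_of x = {y. x \<rightarrow>\<^sup>*\<^bsub>F\<^esub> y}" for x
    using scc_ofI_reachable' by (auto simp: scc_of_def)
  ultimately have "scc_of x = (parcs F)\<^sup>* `` {x}" if "x \<in> pverts F" for x
    using that by auto
  then show "verts ` components_of F = (\<lambda>x. (parcs F)\<^sup>* `` {x}) ` pverts F"
    using sccs_verts_conv sccs_verts_conv_scc_of by (auto simp: components_of_def)
  show "card (components_of F) = card (verts ` components_of F)"
    unfolding components_of_def by (rule card_image[symmetric]) (rule inj_on_verts_sccs)
qed

lemma (in graph) graph_scc:
  assumes "T \<in> sccs"
  shows "graph T"
proof -
  have "induced_subgraph T G" using assms by (rule in_sccs_imp_induced)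
  then interpret T: digraph T by (rule digraphI_induced)
  show ?thesis
    by (rule T.graphI) (rule induced_graph_imp_symmetric[OF sym_arcs \<open>induced_subgraph T G\<close>])
qed

context nbc_graph
begin

text \<open>Paths of the component from its largest node are paths of \<open>F\<close> from a vertex
  that is maximal among the reachable ones, so \<open>apath_zigzag\<close> gives the order
  condition. The parity condition holds along every arc.\<close>

lemma ID_component:
  assumes "T \<in> components_of F" "0 \<notin> V"
  shows "ID_tree T"
proof -
  have T: "T \<in> sccs" using assms by (simp add: components_of_def)
  interpret T: graph T using T by (rule graph_scc)
  have ind: "induced_subgraph T (with_proj F)" using T by (rule in_sccs_imp_induced)
  have sub: "subgraph T (with_proj F)" using ind by (rule induced_imp_subgraph)
  have sc: "strongly_connected T" using T by auto
  have vT: "verts T \<subseteq> V" using subgraph_imp_subverts[OF sub] by simp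
  have forest: "undirected_forest T"
    unfolding undirected_forest_def
    using T.graph_axioms no_cycle subgraph_cycle[OF sub] by fastforce
  have conn: "Digraph_Component.connected T"
    using sc by (intro T.connectedI) (auto simp: strongly_connected_def intro: T.reachable_mk_symmetricI)
  define r where "r = Max (verts T)"
  have "verts T \<in> sccs_verts" using T by (auto intro: in_sccs_vertsI_sccs)
  have "verts T \<noteq> {}" using sc by (simp add: strongly_connected_def)
  then have rT: "r \<in> verts T" by (simp add: r_def)
  have r_max: "y \<le> r" if "r \<rightarrow>\<^sup>*\<^bsub>F\<^esub> y" for y
  proof -
    have "y \<rightarrow>\<^sup>*\<^bsub>F\<^esub> r" using symmetric_reachable[OF sym_arcs that] .
    then have "y \<in> verts T"
      using \<open>verts T \<in> sccs_verts\<close> rT that unfolding in_sccs_verts_conv_reachable by blast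
    then show ?thesis by (simp add: r_def)
  qed
  have desc: "beyond v w" if d: "descendant T r v w" for v w
  proof -
    obtain p where p: "T.apath r p w" "v \<in> set (T.awalk_verts r p)" "w \<noteq> v"
      using d by (auto simp: descendant_def)
    have ap: "apath r p w" using p(1) sub by (rule subgraph_apath_imp_apath)
    then have aw: "awalk r p w" by (simp add: apath_def)
    have "compatible (with_proj F) T" using sub by auto
    then have "v \<in> set (awalk_verts r p)" using p(2) compatible_awalk_verts[of "with_proj F" T]
      by (simp add: awalk_verts_with_proj_eq)
    then obtain i where i: "i < Suc (length p)" "v = awalk_verts r p ! i"
      by (metis in_set_conv_nth length_awalk_verts)
    have "i < length p" using i p(3) awalk_nth(2)[OF aw] by (auto simp: less_Suc_eq)
    \<comment> \<open>The first arc leads from \<open>r\<close> to a smaller vertex, and arcs of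
      \<open>Gamma V\<close> descend only from even vertices.\<close>
    have "even r" if "1 < length p"
    proof -
      have a: "(r, awalk_verts r p ! 1) \<in> parcs F"
        using awalk_nth(3)[OF aw, of 0] awalk_nth(1)[OF aw] that by (cases p) auto
      then have "awalk_verts r p ! 1 \<le> r" by (intro r_max) simp
      then show ?thesis using arc_beyond[OF a] by (auto simp: beyond_def split: if_splits)
    qed
    then show ?thesis
      using apath_zigzag[OF ap r_max _ \<open>i < length p\<close> order_refl] awalk_nth(2)[OF aw] i by simp
  qed
  have child: "odd v \<longleftrightarrow> even w" if "child T r v w" for v w
    using that arcs_ends_mono[OF sub] arc_parity by (auto simp: child_def)
  have "0 \<notin> verts T" using assms vT by auto
  then show ?thesis
    unfolding ID_tree_def undirected_tree_def Let_def r_def[symmetric]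
    using forest conn desc child by (fastforce simp: beyond_def)
qed

lemma in_ID_forests: "0 \<notin> V \<Longrightarrow> F \<in> ID_forests V"
  using undirected_forest ID_component by (simp add: ID_forests_def)

end

lemma ID_forests_imp_nbc:
  assumes "F \<in> ID_forests V"
  shows "nbc V F"
proof -
  have vF: "pverts F = V" and uf: "undirected_forest (with_proj F)"
    and ID: "\<And>T. T \<in> components_of F \<Longrightarrow> ID_tree T"
    using assms by (auto simp: ID_forests_def)
  interpret pair_graph F
    using uf by (intro pair_graphI_graph) (simp add: undirected_forest_def)
  \<comment> \<open>The excluded path involves three edges at once. The component of
    \<open>a\<close> is a single ID tree that contains every arc starting at a vertex reachable from
    \<open>a\<close>.\<close>
  have comp: "\<exists>T :: (nat, nat \<times> nat) pre_digraph. ID_tree_graph T \<and>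
      (\<forall>x y. a \<rightarrow>\<^sup>*\<^bsub>F\<^esub> x \<longrightarrow> (x, y) \<in> parcs F \<longrightarrow> x \<rightarrow>\<^bsub>T\<^esub> y)"
    if "a \<in> V" for a
  proof -
    let ?T = "with_proj F \<restriction> {y. a \<rightarrow>\<^sup>*\<^bsub>F\<^esub> y}"
    have T: "?T \<in> sccs" using induce_reachable_is_in_sccs[of a] that vF by simp
    have "x \<rightarrow>\<^bsub>?T\<^esub> y" if "a \<rightarrow>\<^sup>*\<^bsub>F\<^esub> x" "(x, y) \<in> parcs F" for x y
      using that by (auto simp: arcs_ends_conv intro!: rev_image_eqI[of "(x, y)"] intro: reachable_adj_trans)
    moreover have "ID_tree_graph ?T"
      using graph_scc[OF T] ID[of ?T] T
      by (simp add: ID_tree_graph_def ID_tree_graph_axioms_def components_of_def)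
    ultimately show ?thesis by blast
  qed
  have "(a, b) \<in> parcs (Gamma V)" if ab: "(a, b) \<in> parcs F" for a b
  proof -
    have V: "a \<in> V" "b \<in> V" using in_arcsD1[OF ab] in_arcsD2[OF ab] vF by auto
    obtain T :: "(nat, nat \<times> nat) pre_digraph" where "ID_tree_graph T"
      and T: "\<And>x y. a \<rightarrow>\<^sup>*\<^bsub>F\<^esub> x \<Longrightarrow> (x, y) \<in> parcs F \<Longrightarrow> x \<rightarrow>\<^bsub>T\<^esub> y"
      using comp[OF V(1)] by blast
    then interpret T: ID_tree_graph T by simp
    have "a \<rightarrow>\<^bsub>T\<^esub> b" using T ab V vF by simp
    from T.arc_order[OF this] show ?thesis using V by (simp add: parcs_Gamma)
  qed
  moreover have "(u', v) \<notin> parcs F"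
    if "odd u" "u' < u" "v < v'" "(u, v') \<in> parcs F" "(u, v) \<in> parcs F" for u v u' v'
  proof
    assume c: "(u', v) \<in> parcs F"
    have "u \<in> V" using in_arcsD1[OF that(5)] vF by simp
    then obtain T :: "(nat, nat \<times> nat) pre_digraph" where "ID_tree_graph T"
      and T: "\<And>x y. u \<rightarrow>\<^sup>*\<^bsub>F\<^esub> x \<Longrightarrow> (x, y) \<in> parcs F \<Longrightarrow> x \<rightarrow>\<^bsub>T\<^esub> y"
      using comp by blast
    then interpret T: ID_tree_graph T by simp
    have "u \<rightarrow>\<^sup>*\<^bsub>F\<^esub> u" "u \<rightarrow>\<^sup>*\<^bsub>F\<^esub> v" using \<open>u \<in> V\<close> vF that(5) by auto
    moreover have "u \<rightarrow>\<^sup>*\<^bsub>F\<^esub> u'"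
      using that(5) arcs_symmetric[OF c] by (blast intro: reachable_adj_trans)
    ultimately have "u \<rightarrow>\<^bsub>T\<^esub> v'" "u \<rightarrow>\<^bsub>T\<^esub> v" "u' \<rightarrow>\<^bsub>T\<^esub> v"
      using T that c by blast+
    then show False using T.no_pattern that by blast
  qed
  moreover have "sym (parcs F)" by (auto intro: symI arcs_symmetric)
  ultimately show ?thesis using vF by (auto simp: nbc_def)
qed

lemma ID_forests_eq:
  assumes "finite V" "0 \<notin> V"
  shows "ID_forests V = {F. nbc V F}"
  using assms ID_forests_imp_nbc nbc_graph.in_ID_forests by (auto simp: nbc_graph_def)

section \<open>Toggling the extreme edge of a block\<close>

definition comps :: "'a set \<Rightarrow> 'a rel \<Rightarrow> 'a set set" where
  "comps V E = (\<lambda>x. E\<^sup>* `` {x}) ` V"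

lemma rtrancl_closed:
  assumes "(x, y) \<in> E\<^sup>*" "x \<in> B" "\<And>a b. (a, b) \<in> E \<Longrightarrow> a \<in> B \<Longrightarrow> b \<in> B"
  shows "y \<in> B"
  using assms by (induction) auto

lemma comps_disjoint:
  assumes "sym E" "(x, y) \<notin> E\<^sup>*"
  shows "E\<^sup>* `` {x} \<inter> E\<^sup>* `` {y} = {}"
  using assms by (auto dest: sym_rtrancl[THEN symD] intro: rtrancl_trans)

lemma comps_eq:
  assumes "sym E" "(x, y) \<in> E\<^sup>*"
  shows "E\<^sup>* `` {x} = E\<^sup>* `` {y}"
  using assms by (auto dest: sym_rtrancl[THEN symD] intro: rtrancl_trans)

lemma partition_on_comps:
  assumes "sym E" "E \<subseteq> V \<times> V"
  shows "partition_on V (comps V E)"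
proof (rule partition_onI)
  have "E\<^sup>* `` {x} \<subseteq> V" if "x \<in> V" for x
    using that assms(2) rtrancl_closed[of x _ E V] by blast
  then show "\<Union>(comps V E) = V" by (auto simp: comps_def)
  show "{} \<notin> comps V E" by (auto simp: comps_def)
next
  fix p q assume "p \<in> comps V E" "q \<in> comps V E" "p \<noteq> q"
  then obtain x y where "p = E\<^sup>* `` {x}" "q = E\<^sup>* `` {y}" by (auto simp: comps_def)
  with \<open>p \<noteq> q\<close> show "disjnt p q"
    using comps_eq[OF assms(1), of x y] comps_disjoint[OF assms(1), of x y]
    by (auto simp: disjnt_def)
qed

definition same_block :: "'a set set \<Rightarrow> 'a rel" where
  "same_block \<pi> = {(x, y). \<exists>B\<in>\<pi>. x \<in> B \<and> y \<in> B}"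

lemma same_block_iff:
  assumes "partition_on V \<pi>" "B \<in> \<pi>" "x \<in> B"
  shows "(x, y) \<in> same_block \<pi> \<longleftrightarrow> y \<in> B"
proof -
  have "B = C" if "C \<in> \<pi>" "x \<in> C" for C
    using that assms partition_onD2[OF assms(1)] by (auto dest: disjointD)
  then show ?thesis using assms(2,3) unfolding same_block_def by blast
qed

text \<open>A component is exhausted edge by edge and hence never leaves a block if no edge does.
  Refinement thus becomes a condition on single edges, which toggling an edge inside a block
  preserves.\<close>

lemma refines_comps_iff:
  assumes "sym E" "E \<subseteq> V \<times> V" "partition_on V \<pi>"
  shows "refines V (comps V E) \<pi> \<longleftrightarrow> E \<subseteq> same_block \<pi>"
proof
  assume r: "refines V (comps V E) \<pi>"
  show "E \<subseteq> same_block \<pi>"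
  proof (rule subrelI)
    fix a b assume ab: "(a, b) \<in> E"
    then have "E\<^sup>* `` {a} \<in> comps V E" using assms(2) by (auto simp: comps_def)
    then obtain B where "B \<in> \<pi>" "E\<^sup>* `` {a} \<subseteq> B" using r by (auto simp: refines_def)
    moreover have "b \<in> E\<^sup>* `` {a}" using ab by blast
    ultimately show "(a, b) \<in> same_block \<pi>" by (auto simp: same_block_def)
  qed
next
  assume E: "E \<subseteq> same_block \<pi>"
  have "\<exists>B\<in>\<pi>. E\<^sup>* `` {x} \<subseteq> B" if "x \<in> V" for x
  proof -
    obtain B where B: "B \<in> \<pi>" "x \<in> B" using \<open>x \<in> V\<close> partition_onD1[OF assms(3)] by blast
    have "b \<in> B" if "(a, b) \<in> E" "a \<in> B" for a b
      using same_block_iff[OF assms(3) B(1) that(2)] E that by blast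
    then have "E\<^sup>* `` {x} \<subseteq> B" using B(2) rtrancl_closed[of x _ E B] by blast
    then show ?thesis using B by blast
  qed
  then show "refines V (comps V E) \<pi>"
    using assms partition_on_comps by (auto simp: refines_def comps_def)
qed

text \<open>The new edge merges the two distinct classes of \<open>a\<close> and \<open>b\<close>
  into their union \<open>S\<close>; the remaining classes, collected in \<open>R\<close>, stay as
  they are.\<close>

lemma card_comps_insert:
  assumes "finite V" "sym E" "a \<in> V" "b \<in> V" "(a, b) \<notin> E\<^sup>*"
  shows "card (comps V E) = Suc (card (comps V (insert (a, b) (insert (b, a) E))))"
proof -
  let ?E' = "insert (a, b) (insert (b, a) E)"
  let ?C = "\<lambda>x. E\<^sup>* `` {x}"
  define S where "S = ?C a \<union> ?C b"
  have sym: "(y, x) \<in> E\<^sup>*" if "(x, y) \<in> E\<^sup>*" for x y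
    using that assms(2) by (auto dest: sym_rtrancl[THEN symD])
  have E': "(x, y) \<in> ?E'\<^sup>* \<longleftrightarrow> (x, y) \<in> E\<^sup>* \<or> x \<in> S \<and> y \<in> S" for x y
    using sym unfolding rtrancl_insert S_def by (auto intro: rtrancl_trans)
  have out: "?E'\<^sup>* `` {x} = ?C x" if "x \<notin> S" for x
    using that E' by auto
  have ins: "?E'\<^sup>* `` {x} = S" if "x \<in> S" for x
    using that E' sym by (auto simp: S_def intro: rtrancl_trans)
  define R where "R = ?C ` (V - S)"
  have Cab: "?C x = ?C a \<or> ?C x = ?C b" if "x \<in> S" for x
    using that comps_eq[OF assms(2)] by (auto simp: S_def)
  have "comps V E = insert (?C a) (insert (?C b) R)"
  proof
    show "comps V E \<subseteq> insert (?C a) (insert (?C b) R)"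
      using Cab by (auto simp: comps_def R_def)
  qed (use assms in \<open>auto simp: comps_def R_def\<close>)
  moreover have "comps V ?E' = insert S R"
  proof
    show "comps V ?E' \<subseteq> insert S R"
    proof
      fix B assume "B \<in> comps V ?E'"
      then obtain x where "x \<in> V" "B = ?E'\<^sup>* `` {x}" by (auto simp: comps_def)
      then show "B \<in> insert S R" using ins[of x] out[of x] by (cases "x \<in> S") (auto simp: R_def)
    qed
    have "a \<in> S" by (simp add: S_def)
    have "S \<in> comps V ?E'"
      unfolding comps_def using ins[OF \<open>a \<in> S\<close>] assms(3) by (metis image_eqI)
    moreover have "R \<subseteq> comps V ?E'"
      unfolding R_def comps_def using out by (auto intro!: rev_image_eqI)
    ultimately show "insert S R \<subseteq> comps V ?E'" by simp
  qed
  moreover have "x \<notin> B" if "B \<in> R" "x \<in> S" for B x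
    using that sym by (auto simp: R_def S_def intro: rtrancl_trans)
  then have "?C a \<notin> R" "?C b \<notin> R" "S \<notin> R" by (auto simp: S_def)
  moreover have "?C a \<noteq> ?C b" using assms(5) by blast
  moreover have "finite R" using assms(1) by (simp add: R_def)
  ultimately show ?thesis by simp
qed

text \<open>An excluded path through the new edge stays inside \<open>B\<close>. If the edge is
  \<open>uv'\<close>, then \<open>u = m\<close> leaves no smaller \<open>u'\<close> in
  \<open>B\<close>; if it is \<open>uv\<close> or \<open>u'v\<close>, then \<open>v = M\<close>
  leaves no larger \<open>v'\<close> in \<open>B\<close>.\<close>

lemma nbc_insert:
  assumes nbc: "nbc V F" and m: "m \<in> B" "\<And>x. x \<in> B \<Longrightarrow> m \<le> x" "odd m"
    and M: "M \<in> B" "\<And>x. x \<in> B \<Longrightarrow> x \<le> M" "even M"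
    and B: "B \<subseteq> V" "\<And>x y. (x, y) \<in> parcs F \<Longrightarrow> x \<in> B \<Longrightarrow> y \<in> B"
  shows "nbc V (F\<lparr>parcs := insert (m, M) (insert (M, m) (parcs F))\<rparr>)"
proof -
  have "m < M" using m M by (metis order_neq_le_trans)
  have sub: "parcs F \<subseteq> parcs (Gamma V)"
    using nbc unfolding nbc_def by blast
  have sym: "(y, x) \<in> parcs F" if "(x, y) \<in> parcs F" for x y
    using that nbc unfolding nbc_def by (blast dest: symD)
  have par: "odd x \<longleftrightarrow> even y" if "(x, y) \<in> parcs F" for x y
    using that sub by (fastforce simp: parcs_Gamma)
  have old: "(u', v) \<notin> parcs F"
    if "odd u" "u' < u" "v < v'" "(u, v') \<in> parcs F" "(u, v) \<in> parcs F" for u u' v v'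
    using that nbc unfolding nbc_def by blast
  define E' where "E' = insert (m, M) (insert (M, m) (parcs F))"
  have "(u', v) \<notin> E'"
    if u: "odd u" "u' < u" "v < v'" "(u, v') \<in> E'"
      "(u, v) \<in> E'" for u u' v v'
  proof
    assume c: "(u', v) \<in> E'"
    have uv: "(u, v') = (m, M) \<or> (u, v') \<in> parcs F" "(u, v) = (m, M) \<or> (u, v) \<in> parcs F"
      using u M(3) by (auto simp: E'_def)
    moreover have "even v" using uv(2) par u(1) M(3) by auto
    then have u'v: "(u', v) = (m, M) \<or> (u', v) \<in> parcs F" using c m(3) by (auto simp: E'_def)
    ultimately consider "(u, v') \<in> parcs F" "(u, v) \<in> parcs F" "(u', v) \<in> parcs F"
      | "u \<in> B" "(u, v) = (m, M) \<or> (u', v) = (m, M)"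
      | "(u, v') = (m, M)" "(u, v) \<in> parcs F"
      using m(1) M(1) B(2) sym by blast
    then show False
    proof cases
      case 1
      then show ?thesis using old u by blast
    next
      case 2
      then have "v = M" "v' \<in> B" using uv(1) B(2) M(1) by auto
      then show ?thesis using M(2) u(3) by force
    next
      case 3
      then have "v \<in> B" using m(1) B(2) by auto
      then have "u' \<in> B" using u'v m(1) B(2) sym by blast
      then show ?thesis using m(2) u(2) 3 by force
    qed
  qed
  moreover have "E' \<subseteq> parcs (Gamma V)"
    using sub \<open>m < M\<close> m(1,3) M(1,3) B(1) by (auto simp: E'_def parcs_Gamma)
  moreover have "sym (E')"
    using sym by (auto simp: E'_def intro!: symI)
  moreover have "pverts F = V" using nbc unfolding nbc_def by blast
  ultimately show ?thesis unfolding nbc_def E'_def[symmetric] by simp blast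
qed

text \<open>The condition \<open>nbc\<close> only forbids arcs, so it passes to symmetric subsets of
  the arcs.\<close>

lemma nbc_remove:
  assumes "nbc V F"
  shows "nbc V (F\<lparr>parcs := parcs F - {(m, M), (M, m)}\<rparr>)"
proof -
  define E' where "E' = parcs F - {(m, M), (M, m)}"
  have sub: "E' \<subseteq> parcs F" by (auto simp: E'_def)
  have "sym E'" using assms unfolding nbc_def sym_def E'_def by blast
  moreover have "E' \<subseteq> parcs (Gamma V)" using assms sub unfolding nbc_def by blast
  moreover have "(u', v) \<notin> E'"
    if "odd u" "u' < u" "v < v'" "(u, v') \<in> E'" "(u, v) \<in> E'" for u u' v v'
    using that assms sub unfolding nbc_def by blast
  moreover have "pverts F = V" using assms unfolding nbc_def by blast
  ultimately show ?thesis unfolding nbc_def E'_def[symmetric] by simp blast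
qed

text \<open>On a path from \<open>M\<close> to \<open>m\<close> with at least two arcs, the second
  vertex is odd, being adjacent to \<open>M\<close>. By \<open>apath_zigzag\<close> it would lie
  below the later vertex \<open>m\<close>, which is minimal.\<close>

lemma (in nbc_graph) not_reachable_extremes:
  assumes m: "m \<in> B" "\<And>x. x \<in> B \<Longrightarrow> m \<le> x" "odd m"
    and M: "M \<in> B" "\<And>x. x \<in> B \<Longrightarrow> x \<le> M" "even M"
    and B: "B \<subseteq> V" "\<And>x y. (x, y) \<in> parcs F \<Longrightarrow> x \<in> B \<Longrightarrow> y \<in> B"
    and "(m, M) \<notin> parcs F"
  shows "(M, m) \<notin> (parcs F)\<^sup>*"
proof
  assume "(M, m) \<in> (parcs F)\<^sup>*"
  then have "M \<rightarrow>\<^sup>*\<^bsub>F\<^esub> m"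
    by (induction) (use M(1) B(1) in \<open>auto intro: reachable_adj_trans\<close>)
  then obtain p where p: "apath M p m" by (auto simp: reachable_apath)
  then have aw: "awalk M p m" by (simp add: apath_def)
  have reach: "y \<in> B" if "M \<rightarrow>\<^sup>*\<^bsub>F\<^esub> y" for y
    using rtrancl_closed[of M y "parcs F" B] reachable_rtranclI[OF that] M(1) B(2) by auto
  have "p \<noteq> []" using p m M by (auto simp: apath_Nil_iff)
  have a: "(M, awalk_verts M p ! 1) \<in> parcs F"
    using awalk_nth(3)[OF aw, of 0] awalk_nth(1)[OF aw] \<open>p \<noteq> []\<close> by simp
  show False
  proof (cases "length p = 1")
    case True
    then show False using a awalk_nth(2)[OF aw] arc_sym assms(9) by auto
  next
    case False
    then have "1 < length p" using \<open>p \<noteq> []\<close> by (cases p) auto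
    then have "beyond (awalk_verts M p ! 1) m"
      using apath_zigzag[OF p _ _ _ order_refl, of 1] reach M(2,3) awalk_nth(2)[OF aw] by simp
    moreover have "odd (awalk_verts M p ! 1)" using arc_parity[OF a] M(3) by simp
    moreover have "m \<le> awalk_verts M p ! 1" using B(2)[OF a M(1)] m(2) by simp
    ultimately show False by (simp add: beyond_def)
  qed
qed

definition toggle :: "nat \<Rightarrow> nat \<Rightarrow> nat pair_pre_digraph \<Rightarrow> nat pair_pre_digraph" where
  "toggle m M F = F\<lparr>parcs := if (m, M) \<in> parcs F then parcs F - {(m, M), (M, m)}
     else insert (m, M) (insert (M, m) (parcs F))\<rparr>"

text \<open>Arcs of \<open>F\<close> join elements of one block, so \<open>B\<close> is closed under
  them, as \<open>nbc_insert\<close> and \<open>not_reachable_extremes\<close> require. The toggle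
  is then a sign-reversing involution without fixed points.\<close>

lemma sum_nbc_eq_0:
  assumes V: "finite V" and \<pi>: "partition_on V \<pi>" "B \<in> \<pi>" and mM: "odd (Min B)" "even (Max B)"
  shows "(\<Sum>F | nbc V F \<and> parcs F \<subseteq> same_block \<pi>. (-1) ^ card (comps V (parcs F))) = (0::int)"
proof -
  define m M where "m = Min B" and "M = Max B"
  have B: "B \<subseteq> V" "B \<noteq> {}" "finite B"
    using \<pi> V partition_onD1[OF \<pi>(1)] partition_onD3[OF \<pi>(1)] by (auto intro: finite_subset)
  have m: "m \<in> B" "\<And>x. x \<in> B \<Longrightarrow> m \<le> x" "odd m" using B mM by (auto simp: m_def)
  have M: "M \<in> B" "\<And>x. x \<in> B \<Longrightarrow> x \<le> M" "even M" using B mM by (auto simp: M_def)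
  have block: "(m, M) \<in> same_block \<pi>" "(M, m) \<in> same_block \<pi>"
    using \<pi> m M by (auto simp: same_block_def)
  have B_closed: "y \<in> B" if "parcs F \<subseteq> same_block \<pi>" "(x, y) \<in> parcs F" "x \<in> B" for F x y
    using same_block_iff[OF \<pi> that(3)] that by blast
  have anti: "card (comps V (parcs F)) = Suc (card (comps V (parcs (toggle m M F))))"
    if "nbc V F" "parcs F \<subseteq> same_block \<pi>" "(m, M) \<notin> parcs F" for F
  proof -
    interpret nbc_graph V F using V that by (simp add: nbc_graph_def)
    have "(M, m) \<notin> (parcs F)\<^sup>*"
      by (rule not_reachable_extremes[of m B M])
        (use m M B(1) that(3) in \<open>auto intro: B_closed[OF that(2)]\<close>)
    moreover have "sym (parcs F)" "M \<in> V" "m \<in> V" using arc_sym m(1) M(1) B(1) by (auto intro: symI)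
    ultimately show ?thesis
      using card_comps_insert[OF V, of "parcs F" M m] that(3)
      by (simp add: toggle_def insert_commute)
  qed
  have nbc_toggle: "nbc V (toggle m M F)" if "nbc V F" "parcs F \<subseteq> same_block \<pi>" for F
  proof -
    have "nbc V (F\<lparr>parcs := insert (m, M) (insert (M, m) (parcs F))\<rparr>)"
      by (rule nbc_insert[of V F m B M])
        (use m M B(1) that(1) in \<open>auto intro: B_closed[OF that(2)]\<close>)
    then show ?thesis using nbc_remove[OF that(1)] by (simp add: toggle_def)
  qed
  have toggle_block: "parcs (toggle m M F) \<subseteq> same_block \<pi>" if "parcs F \<subseteq> same_block \<pi>" for F
    using that block by (auto simp: toggle_def)
  have "m \<noteq> M" using m M by auto
  have tt: "toggle m M (toggle m M F) = F" if "nbc V F" for F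
  proof -
    \<comment> \<open>By symmetry both arcs of the edge are present or both are absent, so toggling
      twice restores them together.\<close>
    have "(m, M) \<in> parcs F \<longleftrightarrow> (M, m) \<in> parcs F" using that unfolding nbc_def by (blast dest: symD)
    then have "parcs (toggle m M (toggle m M F)) = parcs F"
      using \<open>m \<noteq> M\<close> by (auto simp: toggle_def)
    then show ?thesis by (intro pair_pre_digraph.equality) (auto simp: toggle_def)
  qed
  have mem: "(m, M) \<in> parcs (toggle m M F) \<longleftrightarrow> (m, M) \<notin> parcs F" for F
    by (simp add: toggle_def)
  show ?thesis
  proof (rule sum_involution_eq_0[where h = "toggle m M"])
    fix F assume "F \<in> {F. nbc V F \<and> parcs F \<subseteq> same_block \<pi>}"
    then have F: "nbc V F" "parcs F \<subseteq> same_block \<pi>" by auto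
    show "toggle m M F \<in> {F. nbc V F \<and> parcs F \<subseteq> same_block \<pi>}"
      using F nbc_toggle toggle_block by simp
    show "toggle m M (toggle m M F) = F" using F tt by simp
    show "toggle m M F \<noteq> F" using mem[of F] by auto
    show "(-1) ^ card (comps V (parcs (toggle m M F))) + (-1) ^ card (comps V (parcs F)) = (0::int)"
      \<comment> \<open>Whichever of \<open>F\<close> and its image lacks the edge has one component
        more; \<open>anti\<close> applies to that one.\<close>
      using anti[OF F] anti[OF nbc_toggle[OF F] toggle_block[OF F(2)]] tt[OF F(1)] mem[of F]
      by (cases "(m, M) \<in> parcs F") auto
  qed
qed

section \<open>The Moebius function of the bond lattice\<close>

text \<open>The Moebius function is determined by its value 1 at \<open>x\<close> and its vanishing
  sums over the nontrivial intervals \<open>[x, y]\<close>. The induction follows its recursion over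
  the elements strictly below \<open>y\<close>.\<close>

lemma moebius_eqI:
  assumes "finite (Field r)" "Partial_order r" "x \<in> Field r" "g x = 1"
    and sum0: "\<And>y. (x, y) \<in> r \<Longrightarrow> y \<noteq> x \<Longrightarrow> (\<Sum>z | (x, z) \<in> r \<and> (z, y) \<in> r. g z) = 0"
    and "(x, y) \<in> r"
  shows "moebius r x y = g y"
  using assms(6)
proof (induction "card (underS r y)" arbitrary: y rule: less_induct)
  case less
  have tr: "trans r" and an: "antisym r" and re: "\<And>a. a \<in> Field r \<Longrightarrow> (a, a) \<in> r"
    using assms(2) by (auto simp: partial_order_on_def preorder_on_def refl_on_def)
  have fin: "finite (underS r z)" for z
    by (rule finite_subset[OF _ assms(1)]) (auto simp: underS_def Field_def)
  show ?case
  proof (cases "x = y")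
    case True
    then show ?thesis using assms less.prems by (subst moebius.simps) simp
  next
    case False
    have "moebius r x z = g z" if "z \<in> underS r y" "(x, z) \<in> r" for z
    proof (rule less.hyps[OF _ that(2)])
      have zy: "z \<noteq> y" "(z, y) \<in> r" using that by (auto simp: underS_def)
      then have "underS r z \<subseteq> underS r y"
        using transD[OF tr] antisymD[OF an] by (auto simp: underS_def)
      moreover have "z \<in> underS r y" "z \<notin> underS r z" using zy by (auto simp: underS_def)
      ultimately have "underS r z \<subset> underS r y" by blast
      then show "card (underS r z) < card (underS r y)" using fin by (rule psubset_card_mono[rotated])
    qed
    then have "moebius r x y = - (\<Sum>z \<in> {z \<in> underS r y. (x, z) \<in> r}. g z)"
      using False less.prems assms by (subst moebius.simps) simp
    moreover have "{z. (x, z) \<in> r \<and> (z, y) \<in> r} = insert y {z \<in> underS r y. (x, z) \<in> r}"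
      using less.prems re by (auto simp: underS_def Field_def)
    moreover have "y \<notin> {z \<in> underS r y. (x, z) \<in> r}" by (simp add: underS_def)
    ultimately show ?thesis
      using sum0[OF less.prems] False fin[of y] by simp
  qed
qed

text \<open>In a tame block with at least two elements, the minimum is adjacent to all even and the maximum
  to all odd elements.\<close>

definition tame :: "nat set \<Rightarrow> bool" where
  "tame B \<longleftrightarrow> B \<noteq> {} \<and> (card B = 1 \<or> odd (Min B) \<and> even (Max B))"

text \<open>A neighbour of the minimum in \<open>B\<close> is larger, which forces the minimum to be
  odd; a neighbour of the maximum is smaller, which forces the maximum to be even.\<close>

lemma tameI:
  assumes "finite B" "B \<noteq> {}"
    and arc: "\<And>x. x \<in> B \<Longrightarrow> B \<noteq> {x} \<Longrightarrow> \<exists>y\<in>B. (x, y) \<in> parcs (Gamma V)"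
  shows "tame B"
proof (cases "card B = 1")
  case False
  have "B \<noteq> {x}" for x using False by auto
  then obtain y z where "y \<in> B" "(Min B, y) \<in> parcs (Gamma V)" "z \<in> B" "(Max B, z) \<in> parcs (Gamma V)"
    using arc Min_in[OF assms(1,2)] Max_in[OF assms(1,2)] by meson
  moreover from this have "Min B \<le> y" "z \<le> Max B" using assms by auto
  ultimately show ?thesis using assms(2) by (auto simp: tame_def parcs_Gamma)
qed (use assms in \<open>simp add: tame_def\<close>)

text \<open>In a connected block with several elements, every vertex has a neighbour, so
  \<open>tameI\<close> applies. Conversely, even elements are joined to the odd minimum, odd
  elements to the even maximum, and these two to each other.\<close>

lemma connected_Gamma_iff:
  assumes "finite V" "B \<subseteq> V"
  shows "Digraph_Component.connected (with_proj (Gamma V) \<restriction> B) \<longleftrightarrow> tame B"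
    (is "Digraph_Component.connected ?G \<longleftrightarrow> _")
proof
  have fin: "finite B" using assms finite_subset by blast
  have ends: "arcs_ends ?G = parcs (Gamma V) \<inter> B \<times> B" by (auto simp: arcs_ends_conv)
  assume conn: "Digraph_Component.connected ?G"
  show "tame B"
  proof (rule tameI[OF fin])
    show "B \<noteq> {}" using conn by (simp add: connected_conv)
    fix x assume x: "x \<in> B" "B \<noteq> {x}"
    then obtain z where z: "z \<in> B" "z \<noteq> x" by blast
    have "(x, z) \<in> rtrancl_on B ((parcs (Gamma V) \<inter> B \<times> B)\<^sup>s)"
      using conn x z unfolding connected_conv ends by simp
    then have "(x, z) \<in> ((parcs (Gamma V) \<inter> B \<times> B)\<^sup>s)\<^sup>*" by (rule rtrancl_on_rtranclI)
    then obtain y where "(x, y) \<in> (parcs (Gamma V) \<inter> B \<times> B)\<^sup>s"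
      using z(2) by (auto elim: converse_rtranclE)
    then show "\<exists>y\<in>B. (x, y) \<in> parcs (Gamma V)"
      by (auto simp: symcl_def parcs_Gamma)
  qed
next
  have fin: "finite B" using assms finite_subset by blast
  interpret H: wf_digraph ?G by unfold_locales auto
  have arc: "x \<rightarrow>\<^bsub>?G\<^esub> y"
    if "x \<in> B" "y \<in> B" "x < y \<and> odd x \<and> even y \<or> y < x \<and> odd y \<and> even x" for x y
    using that assms by (auto simp: arcs_ends_conv parcs_Gamma intro!: rev_image_eqI[of "(x, y)"])
  assume "tame B"
  then have ne: "B \<noteq> {}" by (simp add: tame_def)
  have mB: "Min B \<in> B" "Max B \<in> B" using fin ne by auto
  have mM: "Min B \<le> x" "x \<le> Max B" if "x \<in> B" for x using fin that by auto
  have reach: "x \<rightarrow>\<^sup>*\<^bsub>?G\<^esub> Min B \<and> Min B \<rightarrow>\<^sup>*\<^bsub>?G\<^esub> x" if "x \<in> B" for x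
  proof (cases "card B = 1")
    case True
    then obtain b where "B = {b}" by (auto simp: card_1_singleton_iff)
    then show ?thesis using that H.reachable_refl[of b] by simp
  next
    case False
    then have par: "odd (Min B)" "even (Max B)" using \<open>tame B\<close> by (auto simp: tame_def)
    have less: "Min B < y" if "y \<in> B" "even y" for y
      using mM(1)[OF that(1)] that par by (metis order_le_less)
    have less': "y < Max B" if "y \<in> B" "odd y" for y
      using mM(2)[OF that(1)] that par by (metis order_le_less)
    have down: "y \<rightarrow>\<^bsub>?G\<^esub> Min B \<and> Min B \<rightarrow>\<^bsub>?G\<^esub> y" if "y \<in> B" "even y" for y
      using arc less[OF that] that par mB by blast
    show ?thesis
    proof (cases "even x")
      case True
      then show ?thesis using down[OF \<open>x \<in> B\<close>] by blast
    next
      case False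
      then have "x \<rightarrow>\<^bsub>?G\<^esub> Max B" "Max B \<rightarrow>\<^bsub>?G\<^esub> x" using arc less' that par mB by blast+
      then show ?thesis
        using down[OF mB(2) par(2)] by (blast intro: H.reachable_adj_trans H.reachable_adjI)
    qed
  qed
  show "Digraph_Component.connected ?G"
    by (rule H.connectedI) (use ne reach in \<open>auto intro: H.reachable_mk_symmetricI H.reachable_trans\<close>)
qed

lemma bonds_Gamma:
  assumes "finite V"
  shows "bonds (Gamma V) = {\<pi>. partition_on V \<pi> \<and> (\<forall>B\<in>\<pi>. tame B)}"
proof -
  have "Digraph_Component.connected (with_proj (Gamma V) \<restriction> B) \<longleftrightarrow> tame B"
    if "partition_on V \<pi>" "B \<in> \<pi>" for \<pi> B
    using connected_Gamma_iff[OF assms, of B] partition_onD1[OF that(1)] that(2) by blast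
  then show ?thesis by (auto simp: bonds_def)
qed

text \<open>Every vertex of a component with several elements has an arc of \<open>F\<close>, hence
  of \<open>Gamma V\<close>, within the component; this is all that \<open>tameI\<close>
  asks.\<close>

lemma comps_in_bonds:
  assumes "finite V" "nbc V F"
  shows "comps V (parcs F) \<in> bonds (Gamma V)"
proof -
  interpret nbc_graph V F using assms by (simp add: nbc_graph_def)
  have part: "partition_on V (comps V (parcs F))"
    using arc_sym arc_Gamma by (intro partition_on_comps symI) (auto simp: parcs_Gamma)
  moreover have "tame B" if B: "B \<in> comps V (parcs F)" for B
  proof (rule tameI)
    have "B \<subseteq> V" using that partition_onD1[OF part] by blast
    then show "finite B" using assms(1) by (rule finite_subset)
    show "B \<noteq> {}" using that partition_onD3[OF part] by blast
    obtain b where b: "B = (parcs F)\<^sup>* `` {b}" using B by (auto simp: comps_def)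
    fix x assume x: "x \<in> B" "B \<noteq> {x}"
    then have "B = (parcs F)\<^sup>* `` {x}"
      using b arc_sym comps_eq[of "parcs F" b x] by (auto intro: symI)
    moreover from this obtain z where "(x, z) \<in> (parcs F)\<^sup>*" "z \<noteq> x" using x by blast
    then obtain y where "(x, y) \<in> parcs F" by (auto elim: converse_rtranclE)
    ultimately show "\<exists>y\<in>B. (x, y) \<in> parcs (Gamma V)" using arc_Gamma by blast
  qed
  ultimately show ?thesis using assms by (simp add: bonds_Gamma)
qed

section \<open>The bond lattice as a finite poset\<close>

locale Gamma_bonds =
  fixes V :: "nat set"
  assumes V: "finite V" "0 \<notin> V"
begin

abbreviation "r \<equiv> bond_lattice (Gamma V)"

definition singletons :: "nat set set" where "singletons = (\<lambda>x. {x}) ` V"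

lemma bonds_partition: "\<pi> \<in> bonds (Gamma V) \<Longrightarrow> partition_on V \<pi>"
  by (simp add: bonds_def)

lemma r_iff: "(\<sigma>, \<pi>) \<in> r \<longleftrightarrow> \<sigma> \<in> bonds (Gamma V) \<and> \<pi> \<in> bonds (Gamma V) \<and> refines V \<sigma> \<pi>"
  by (auto simp: bond_lattice_def relation_of_def)

lemma Field_r: "Field r = bonds (Gamma V)"
proof -
  have "(\<pi>, \<pi>) \<in> r" if "\<pi> \<in> bonds (Gamma V)" for \<pi>
    using that refines_refl[OF bonds_partition[OF that]] by (simp add: r_iff)
  then have "bonds (Gamma V) \<subseteq> Field r" by (blast intro: FieldI1)
  then show ?thesis by (auto simp: Field_def r_iff)
qed

lemma finite_bonds: "finite (bonds (Gamma V))"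
  by (rule finite_subset[OF _ finitely_many_partition_on[OF V(1)]]) (auto dest: bonds_partition)

lemma partial_order_r: "Partial_order r"
proof -
  have "refl_on (Field r) r" "r \<subseteq> Field r \<times> Field r"
    by (auto simp: refl_on_def Field_r r_iff intro: refines_refl bonds_partition)
  moreover have "trans r" by (rule transI) (auto simp: r_iff intro: refines_trans)
  moreover have "antisym r" by (rule antisymI) (metis r_iff refines_asym)
  ultimately show ?thesis by (simp add: partial_order_on_def preorder_on_def)
qed

lemma singletons_in_bonds: "singletons \<in> bonds (Gamma V)"
  using partition_on_singletons V by (auto simp: bonds_Gamma singletons_def tame_def)

lemma singletons_least: "\<pi> \<in> bonds (Gamma V) \<Longrightarrow> (singletons, \<pi>) \<in> r"
  using bonds_partition partition_onD1 singletons_in_bonds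
  by (fastforce simp: r_iff refines_def singletons_def)

lemma poset_bot_eq: "poset_bot r = singletons"
  unfolding poset_bot_def Field_r
proof (rule the_equality)
  show "singletons \<in> bonds (Gamma V) \<and> (\<forall>y\<in>bonds (Gamma V). (singletons, y) \<in> r)"
    using singletons_in_bonds singletons_least by blast
  show "x = singletons" if "x \<in> bonds (Gamma V) \<and> (\<forall>y\<in>bonds (Gamma V). (x, y) \<in> r)" for x
    using that singletons_in_bonds singletons_least[of x] by (meson r_iff refines_asym)
qed

text \<open>A partition of \<open>V\<close> into blocks of size one is \<open>singletons\<close>,
  and a larger block of a bond is tame. Such a block supplies the edge to toggle, and later the
  block to split.\<close>

lemma ex_big_block:
  assumes "\<pi> \<in> bonds (Gamma V)" "\<pi> \<noteq> singletons"
  obtains B where "B \<in> \<pi>" "finite B" "1 < card B" "odd (Min B)" "even (Max B)" "B \<subseteq> V"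
proof -
  have part: "partition_on V \<pi>" using assms bonds_partition by simp
  have fin: "finite B" "B \<noteq> {}" if "B \<in> \<pi>" for B
  proof -
    have "B \<subseteq> V" using that partition_onD1[OF part] by blast
    then show "finite B" using V(1) by (rule finite_subset)
    show "B \<noteq> {}" using that partition_onD3[OF part] by blast
  qed
  have "\<exists>B\<in>\<pi>. card B \<noteq> 1"
  proof (rule ccontr)
    assume "\<not> ?thesis"
    then have one: "\<exists>x. B = {x}" if "B \<in> \<pi>" for B
      using that by (auto simp: card_1_singleton_iff)
    have "{x} \<in> \<pi>" if x: "x \<in> V" for x
    proof -
      obtain B where "B \<in> \<pi>" "x \<in> B" using x partition_onD1[OF part] by blast
      then show ?thesis using one by force
    qed
    moreover have "B \<in> singletons" if "B \<in> \<pi>" for B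
      using one[OF that] that partition_onD1[OF part] unfolding singletons_def by blast
    ultimately have "\<pi> = singletons" by (auto simp: singletons_def)
    then show False using assms(2) by simp
  qed
  then obtain B where B: "B \<in> \<pi>" "card B \<noteq> 1" by blast
  then have "0 < card B" using fin by (simp add: card_gt_0_iff)
  moreover have "tame B" using assms(1) B(1) V by (simp add: bonds_Gamma)
  ultimately show ?thesis
    using that[of B] B fin partition_onD1[OF part] by (auto simp: tame_def)
qed

section \<open>Signed counts of ID forests and the Moebius function\<close>

definition N :: "nat set set \<Rightarrow> nat" where
  "N \<pi> = card {F \<in> ID_forests V. verts ` components_of F = \<pi>}"

lemma nbc_components:
  assumes "nbc V F"
  shows "verts ` components_of F = comps V (parcs F)" "card (components_of F) = card (comps V (parcs F))"
proof -
  interpret nbc_graph V F using assms V by (simp add: nbc_graph_def)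
  show "verts ` components_of F = comps V (parcs F)"
    using components_of_eq(1)[OF pair_graph] by (simp add: comps_def)
  then show "card (components_of F) = card (comps V (parcs F))"
    using components_of_eq(2)[OF pair_graph] by simp
qed

lemma N_eq: "N \<pi> = card {F. nbc V F \<and> comps V (parcs F) = \<pi>}"
  unfolding N_def ID_forests_eq[OF V] using nbc_components(1) by (intro arg_cong[of _ _ card]) auto

lemma finite_nbc: "finite {F. nbc V F}"
proof (rule finite_subset)
  show "{F. nbc V F} \<subseteq> (\<lambda>E. \<lparr>pverts = V, parcs = E\<rparr>) ` Pow (parcs (Gamma V))"
  proof clarify
    fix F assume "nbc V F"
    then have "pverts F = V" "parcs F \<subseteq> parcs (Gamma V)" unfolding nbc_def by blast+
    then show "F \<in> (\<lambda>E. \<lparr>pverts = V, parcs = E\<rparr>) ` Pow (parcs (Gamma V))"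
      by (intro rev_image_eqI[of "parcs F"]) auto
  qed
  have "finite (parcs (Gamma V))"
    by (rule finite_subset[of _ "V \<times> V"]) (auto simp: Gamma_def V(1))
  then show "finite ((\<lambda>E. \<lparr>pverts = V, parcs = E\<rparr>) ` Pow (parcs (Gamma V)))" by simp
qed

text \<open>The forests are grouped by their partition into components.\<close>

lemma sum_N:
  assumes "finite P"
  shows "(\<Sum>\<sigma>\<in>P. g \<sigma> * int (N \<sigma>)) = (\<Sum>F | nbc V F \<and> comps V (parcs F) \<in> P. g (comps V (parcs F)))"
proof -
  let ?S = "{F. nbc V F \<and> comps V (parcs F) \<in> P}"
  have "finite ?S" by (rule finite_subset[OF _ finite_nbc]) auto
  then have "(\<Sum>F\<in>?S. g (comps V (parcs F))) =
      (\<Sum>\<sigma>\<in>P. \<Sum>F | F \<in> ?S \<and> comps V (parcs F) = \<sigma>. g (comps V (parcs F)))"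
    using assms by (intro sum.group[symmetric]) auto
  also have "\<dots> = (\<Sum>\<sigma>\<in>P. g \<sigma> * int (N \<sigma>))"
  proof (rule sum.cong[OF refl])
    fix \<sigma> assume "\<sigma> \<in> P"
    then have "{F. F \<in> ?S \<and> comps V (parcs F) = \<sigma>} = {F. nbc V F \<and> comps V (parcs F) = \<sigma>}" by auto
    then show "(\<Sum>F | F \<in> ?S \<and> comps V (parcs F) = \<sigma>. g (comps V (parcs F))) = g \<sigma> * int (N \<sigma>)"
      by (simp add: N_eq)
  qed
  finally show ?thesis by simp
qed

text \<open>Since \<open>singletons\<close> is the bottom, the interval consists of the bonds
  refining \<pi>. By \<open>sum_N\<close> and \<open>refines_comps_iff\<close> the sum runs over the
  \<open>nbc\<close> graphs whose edges stay inside blocks of \<pi>, where toggling cancels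
  it.\<close>

lemma sum_below_eq_0:
  assumes "\<pi> \<in> bonds (Gamma V)" "\<pi> \<noteq> singletons"
  shows "(\<Sum>\<sigma> | (singletons, \<sigma>) \<in> r \<and> (\<sigma>, \<pi>) \<in> r. (-1) ^ card \<sigma> * int (N \<sigma>)) = 0"
proof -
  obtain B where B: "B \<in> \<pi>" "odd (Min B)" "even (Max B)" using ex_big_block[OF assms] by blast
  have part: "partition_on V \<pi>" using assms bonds_partition by simp
  have P: "{\<sigma>. (singletons, \<sigma>) \<in> r \<and> (\<sigma>, \<pi>) \<in> r} = {\<sigma> \<in> bonds (Gamma V). refines V \<sigma> \<pi>}"
    using singletons_least assms by (auto simp: r_iff)
  have "refines V (comps V (parcs F)) \<pi> \<longleftrightarrow> parcs F \<subseteq> same_block \<pi>" if "nbc V F" for F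
    using that part unfolding nbc_def
    by (intro refines_comps_iff) (auto simp: Gamma_def)
  then have S: "{F. nbc V F \<and> comps V (parcs F) \<in> {\<sigma> \<in> bonds (Gamma V). refines V \<sigma> \<pi>}} =
      {F. nbc V F \<and> parcs F \<subseteq> same_block \<pi>}"
    using comps_in_bonds[OF V(1)] by auto
  show ?thesis
    unfolding P
    using sum_N[of "{\<sigma> \<in> bonds (Gamma V). refines V \<sigma> \<pi>}" "\<lambda>\<sigma>. (-1) ^ card \<sigma>"] finite_bonds
      sum_nbc_eq_0[OF V(1) part B] unfolding S by simp
qed

text \<open>Any edge would put two vertices into one component, so only the edgeless graph
  remains.\<close>

lemma N_bot: "N singletons = 1"
proof -
  have "parcs F = {}" if "nbc V F" "comps V (parcs F) = singletons" for F
  proof (rule ccontr)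
    assume "parcs F \<noteq> {}"
    then obtain a b where ab: "(a, b) \<in> parcs F" by auto
    then have "(a, b) \<in> parcs (Gamma V)" using that unfolding nbc_def by blast
    then have "a \<in> V" "a \<noteq> b" by (auto simp: parcs_Gamma)
    then have "(parcs F)\<^sup>* `` {a} \<in> singletons" using that(2) by (auto simp: comps_def)
    then obtain x where x: "(parcs F)\<^sup>* `` {a} = {x}" unfolding singletons_def by blast
    have "a \<in> (parcs F)\<^sup>* `` {a}" "b \<in> (parcs F)\<^sup>* `` {a}" using ab by auto
    then show False using \<open>a \<noteq> b\<close> unfolding x by simp
  qed
  moreover have "pverts F = V" if "nbc V F" for F using that unfolding nbc_def by blast
  ultimately have "F = \<lparr>pverts = V, parcs = {}\<rparr>" if "nbc V F" "comps V (parcs F) = singletons" for F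
    using that by (intro pair_pre_digraph.equality) simp_all
  moreover have "nbc V \<lparr>pverts = V, parcs = {}\<rparr>" by (simp add: nbc_def sym_def)
  moreover have "comps V (parcs \<lparr>pverts = V, parcs = {}\<rparr>) = singletons"
    by (simp add: comps_def singletons_def)
  ultimately have "{F. nbc V F \<and> comps V (parcs F) = singletons} = {\<lparr>pverts = V, parcs = {}\<rparr>}"
    by blast
  then show ?thesis by (simp add: N_eq)
qed

text \<open>The bottom has \<open>card V\<close> blocks and one ID forest, so the factor
  \<open>(-1) ^ card V\<close> normalises the signed count to 1 there. The interval sums vanish by
  \<open>sum_below_eq_0\<close>.\<close>

lemma moebius_bot:
  assumes "\<pi> \<in> bonds (Gamma V)"
  shows "moebius r (poset_bot r) \<pi> = (-1) ^ card V * ((-1) ^ card \<pi> * int (N \<pi>))"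
  unfolding poset_bot_eq
proof (rule moebius_eqI[where g = "\<lambda>\<pi>. (-1) ^ card V * ((-1) ^ card \<pi> * int (N \<pi>))"])
  have "card singletons = card V" unfolding singletons_def by (rule card_image) simp
  then show "(-1) ^ card V * ((-1) ^ card singletons * int (N singletons)) = 1"
    by (simp add: N_bot flip: power_mult_distrib)
  show "(\<Sum>z | (singletons, z) \<in> r \<and> (z, y) \<in> r. (-1) ^ card V * ((-1) ^ card z * int (N z))) = 0"
    if "(singletons, y) \<in> r" "y \<noteq> singletons" for y
    using sum_below_eq_0[of y] that unfolding r_iff by (simp flip: sum_distrib_left)
qed (use assms singletons_in_bonds singletons_least finite_bonds partial_order_r in \<open>auto simp: Field_r\<close>)

end

section \<open>Rank and characteristic polynomial\<close>

text \<open>Sending a block of \<open>P\<close> to the block of \<open>Q\<close> containing it is a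
  surjection \<open>f\<close>. With equal finite cardinalities it is injective, and then each block
  of \<open>Q\<close> is covered by a single block of \<open>P\<close>.\<close>

lemma refines_card:
  assumes "finite A" "refines A P Q"
  shows "card Q \<le> card P" "card Q = card P \<Longrightarrow> P = Q"
proof -
  have P: "partition_on A P" and Q: "partition_on A Q" using assms by (auto simp: refines_def)
  have finP: "finite P" and finQ: "finite Q" using assms P Q finite_elements by blast+
  obtain f where f: "\<And>p. p \<in> P \<Longrightarrow> f p \<in> Q \<and> p \<subseteq> f p"
    using assms(2) unfolding refines_def by metis
  have cover: "\<exists>p\<in>P. x \<in> p \<and> f p = q" if "q \<in> Q" "x \<in> q" for q x
  proof -
    have "x \<in> A" using that partition_onD1[OF Q] by blast
    then obtain p where p: "p \<in> P" "x \<in> p" using partition_onD1[OF P] by blast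
    then have "f p = q"
      using f[OF p(1)] that partition_onD2[OF Q] by (metis IntI disjointD emptyE subsetD)
    then show ?thesis using p by blast
  qed
  have surj: "f ` P = Q"
  proof
    show "Q \<subseteq> f ` P"
      using cover partition_onD3[OF Q] by (metis all_not_in_conv image_eqI subsetI)
  qed (use f in blast)
  then show "card Q \<le> card P" using finP card_image_le by blast
  assume "card Q = card P"
  then have inj: "inj_on f P" using surj finP by (simp add: eq_card_imp_inj_on)
  have fp: "f p = p" if p: "p \<in> P" for p
  proof
    show "f p \<subseteq> p"
    proof
      fix x assume "x \<in> f p"
      then obtain p' where "p' \<in> P" "x \<in> p'" "f p' = f p" using cover f[OF p] by blast
      then show "x \<in> p" using inj that by (auto dest: inj_onD)
    qed
  qed (use f that in blast)
  have "f ` P = P" using fp by simp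
  then show "P = Q" using surj by simp
qed

section \<open>Chains and rank in the bond lattice\<close>

context Gamma_bonds
begin

lemma card_singletons: "card singletons = card V"
  unfolding singletons_def by (rule card_image) simp

lemma card_bond_le: "\<pi> \<in> bonds (Gamma V) \<Longrightarrow> card \<pi> \<le> card V"
  using singletons_least[of \<pi>] refines_card(1)[OF V(1)] card_singletons by (metis r_iff)

text \<open>Split one element off a block so that the rest stays tame. From a pair take the maximum,
  which leaves a singleton; from a larger block take an element other than the extremes, which keeps
  both.\<close>

lemma ex_coatom:
  assumes "\<pi> \<in> bonds (Gamma V)" "\<pi> \<noteq> singletons"
  obtains \<sigma> where "\<sigma> \<in> bonds (Gamma V)" "(\<sigma>, \<pi>) \<in> r" "card \<sigma> = Suc (card \<pi>)"
proof -
  have part: "partition_on V \<pi>" using assms bonds_partition by simp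
  then have "finite \<pi>" using V finite_elements by blast
  obtain B where B: "B \<in> \<pi>" "finite B" "1 < card B" "odd (Min B)" "even (Max B)" "B \<subseteq> V"
    using ex_big_block[OF assms] by blast
  have "B \<noteq> {}" using B by auto
  then have mM: "Min B \<in> B" "Max B \<in> B" "Min B \<noteq> Max B"
    using Min_in[OF B(2)] Max_in[OF B(2)] B(4,5) \<open>B \<noteq> {}\<close> by metis+
  have "\<exists>x\<in>B. tame (B - {x})"
  proof (cases "card B = 2")
    case True
    then have "card (B - {Max B}) = 1" using B(2) mM by simp
    moreover from this have "B - {Max B} \<noteq> {}" by force
    ultimately show ?thesis using mM by (auto simp: tame_def)
  next
    case False
    have "\<not> B \<subseteq> {Min B, Max B}"
    proof
      assume "B \<subseteq> {Min B, Max B}"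
      then have "card B \<le> 2" using card_mono[of "{Min B, Max B}" B] mM by simp
      then show False using B(3) False by simp
    qed
    then obtain x where x: "x \<in> B" "x \<noteq> Min B" "x \<noteq> Max B" by blast
    have "Min (B - {x}) = Min B" "Max (B - {x}) = Max B"
      using x mM B(2) by (auto intro!: Min_eqI Max_eqI)
    then have "tame (B - {x})" using B mM x by (auto simp: tame_def)
    then show ?thesis using x by blast
  qed
  then obtain x where x: "x \<in> B" "tame (B - {x})" by blast
  define R where "R = \<pi> - {B}"
  have \<pi>: "\<pi> = insert B R" "B \<notin> R" using B by (auto simp: R_def)
  have dis: "disjnt B (\<Union>R)"
    using partition_onD2[OF part] B(1) by (auto simp: R_def disjnt_def dest: disjointD)
  have R: "partition_on (V - B) R" using part partition_on_insert[OF dis] \<pi> by simp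
  let ?\<sigma> = "insert {x} (insert (B - {x}) R)"
  have ne: "B - {x} \<noteq> {}" using x(2) by (simp add: tame_def)
  have d1: "disjnt (B - {x}) (\<Union>R)" using dis by (auto simp: disjnt_def)
  have d2: "disjnt {x} (\<Union>(insert (B - {x}) R))" using dis x(1) by (auto simp: disjnt_def)
  have "V - {x} - (B - {x}) = V - B" using x by auto
  then have "partition_on V ?\<sigma>"
    using R ne x(1) B(6) unfolding partition_on_insert[OF d2] partition_on_insert[OF d1] by auto
  moreover have "tame C" if "C \<in> \<pi>" for C using that assms(1) V(1) by (simp add: bonds_Gamma)
  ultimately have bond: "?\<sigma> \<in> bonds (Gamma V)"
    using x(2) \<pi> V(1) by (auto simp: bonds_Gamma) (auto simp: tame_def)
  moreover have "refines V ?\<sigma> \<pi>"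
    using \<open>partition_on V ?\<sigma>\<close> part x(1) \<pi> by (auto simp: refines_def)
  moreover have "card ?\<sigma> = Suc (card \<pi>)"
  proof -
    have "B - {x} \<notin> R" using d1 ne by (auto simp: disjnt_def)
    moreover have "{x} \<notin> insert (B - {x}) R" using d2 by (auto simp: disjnt_def)
    ultimately show ?thesis using \<open>finite \<pi>\<close> \<pi> by simp
  qed
  ultimately show ?thesis using that assms(1) by (simp add: r_iff)
qed

lemma refl_r: "\<pi> \<in> bonds (Gamma V) \<Longrightarrow> (\<pi>, \<pi>) \<in> r"
  using singletons_least partial_order_r
  by (simp add: partial_order_on_def preorder_on_def refl_on_def Field_r)

lemma trans_r: "(\<rho>, \<sigma>) \<in> r \<Longrightarrow> (\<sigma>, \<pi>) \<in> r \<Longrightarrow> (\<rho>, \<pi>) \<in> r"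
  using partial_order_r by (auto simp: partial_order_on_def preorder_on_def dest: transD)

lemma ChainsD:
  assumes "C \<in> Chains (Restr r (under r \<pi>))" "\<sigma> \<in> C"
  shows "(\<sigma>, \<pi>) \<in> r" "\<sigma> \<in> bonds (Gamma V)"
  using assms by (auto simp: Chains_def under_def r_iff)

text \<open>Repeated use of \<open>ex_coatom\<close> descends to \<open>singletons\<close>, with one
  more block at each step.\<close>

lemma ex_long_chain:
  assumes "\<pi> \<in> bonds (Gamma V)"
  shows "\<exists>C \<in> Chains (Restr r (under r \<pi>)). card C = Suc (card V - card \<pi>)"
  using assms
proof (induction "card V - card \<pi>" arbitrary: \<pi> rule: less_induct)
  case less
  show ?case
  proof (cases "\<pi> = singletons")
    case True
    then have "{\<pi>} \<in> Chains (Restr r (under r \<pi>))"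
      using refl_r[OF less.prems] by (auto simp: Chains_def under_def)
    then show ?thesis using True card_singletons by force
  next
    case False
    obtain \<sigma> where \<sigma>: "\<sigma> \<in> bonds (Gamma V)" "(\<sigma>, \<pi>) \<in> r" "card \<sigma> = Suc (card \<pi>)"
      using ex_coatom[OF less.prems False] by blast
    have "card \<sigma> \<le> card V" using \<sigma>(1) by (rule card_bond_le)
    then have "card V - card \<sigma> < card V - card \<pi>" using \<sigma>(3) by linarith
    then obtain C where C: "C \<in> Chains (Restr r (under r \<sigma>))" "card C = Suc (card V - card \<sigma>)"
      using less.hyps \<sigma>(1) by blast
    have "finite C" using C(2) by (intro card_ge_0_finite) simp
    have up: "(\<tau>, \<pi>) \<in> r" if "\<tau> \<in> C" for \<tau>
      using ChainsD(1)[OF C(1) that] \<sigma>(2) trans_r by blast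
    have "\<pi> \<notin> C"
    proof
      assume "\<pi> \<in> C"
      then have "refines V \<pi> \<sigma>" using ChainsD(1)[OF C(1)] by (simp add: r_iff)
      then show False using refines_card(1)[OF V(1)] \<sigma>(3) by fastforce
    qed
    moreover have "insert \<pi> C \<in> Chains (Restr r (under r \<pi>))"
      using C(1) up refl_r[OF less.prems] by (auto simp: Chains_def under_def)
    ultimately show ?thesis
      using C(2) \<open>finite C\<close> \<sigma>(3) \<open>card \<sigma> \<le> card V\<close> by (intro bexI[of _ "insert \<pi> C"]) auto
  qed
qed

lemma poset_rank_eq:
  assumes "\<pi> \<in> bonds (Gamma V)"
  shows "poset_rank r \<pi> = card V - card \<pi>"
  unfolding poset_rank_def poset_length_def
proof (rule Max_eqI)
  let ?s = "Restr r (under r \<pi>)"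
  have "Chains ?s \<subseteq> Pow (bonds (Gamma V))" using ChainsD(2) by blast
  then have "finite (Chains ?s)" using finite_bonds by (meson finite_Pow_iff finite_subset)
  then show "finite ((\<lambda>C. card C - 1) ` Chains ?s)" by simp
  show "card V - card \<pi> \<in> (\<lambda>C. card C - 1) ` Chains ?s"
    using ex_long_chain[OF assms] by force
  fix n assume "n \<in> (\<lambda>C. card C - 1) ` Chains ?s"
  then obtain C where C: "C \<in> Chains ?s" "n = card C - 1" by blast
  \<comment> \<open>Members of a chain are comparable, so by \<open>refines_card\<close> they are
    told apart by their numbers of blocks. These lie between \<open>card \<pi>\<close> and
    \<open>card V\<close>, which bounds the chain.\<close>
  have "inj_on card C"
  proof (rule inj_onI)
    fix a b assume ab: "a \<in> C" "b \<in> C" "card a = card b"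
    then consider "refines V a b" | "refines V b a" using C(1) by (auto simp: Chains_def r_iff)
    then show "a = b" using refines_card(2)[OF V(1)] ab(3) by cases metis+
  qed
  moreover have "card ` C \<subseteq> {card \<pi>..card V}"
    using ChainsD[OF C(1)] card_bond_le refines_card(1)[OF V(1)] by (force simp: r_iff)
  ultimately have "card C \<le> card {card \<pi>..card V}"
    by (metis card_image card_mono finite_atLeastAtMost)
  then show "n \<le> card V - card \<pi>" using C(2) by simp
qed

section \<open>The top element and the characteristic polynomial\<close>

lemma connected_imp_top_bond:
  assumes "Digraph_Component.connected (with_proj (Gamma V))"
  shows "{V} \<in> bonds (Gamma V)" "V \<noteq> {}"
proof -
  have "with_proj (Gamma V) \<restriction> V = with_proj (Gamma V)"
    by (auto simp: induce_subgraph_def with_proj_def Gamma_def)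
  then have "tame V" using connected_Gamma_iff[OF V(1) order_refl] assms by simp
  then show "V \<noteq> {}" by (simp add: tame_def)
  then show "{V} \<in> bonds (Gamma V)"
    using \<open>tame V\<close> V(1) partition_on_space by (simp add: bonds_Gamma)
qed

lemma top_greatest:
  assumes "{V} \<in> bonds (Gamma V)" "\<pi> \<in> bonds (Gamma V)"
  shows "(\<pi>, {V}) \<in> r"
proof -
  have "B \<subseteq> V" if "B \<in> \<pi>" for B
    using that partition_onD1[OF bonds_partition[OF assms(2)]] by blast
  then show ?thesis using assms bonds_partition by (simp add: r_iff refines_def)
qed

lemma poset_top_eq:
  assumes "{V} \<in> bonds (Gamma V)"
  shows "poset_top r = {V}"
  unfolding poset_top_def Field_r
proof (rule the_equality)
  show "{V} \<in> bonds (Gamma V) \<and> (\<forall>y\<in>bonds (Gamma V). (y, {V}) \<in> r)"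
    using assms top_greatest by blast
  show "x = {V}" if "x \<in> bonds (Gamma V) \<and> (\<forall>y\<in>bonds (Gamma V). (y, x) \<in> r)" for x
    using that assms top_greatest[of x] by (meson r_iff refines_asym)
qed

text \<open>The principal ideal of the top is the whole lattice, so the length is the rank of
  \<open>{V}\<close>.\<close>

lemma poset_length_eq:
  assumes "{V} \<in> bonds (Gamma V)"
  shows "poset_length r = card V - 1"
proof -
  have "under r {V} = bonds (Gamma V)"
    using top_greatest[OF assms] by (auto simp: under_def r_iff)
  moreover have "r \<subseteq> bonds (Gamma V) \<times> bonds (Gamma V)" by (rule subrelI) (simp add: r_iff)
  ultimately have "Restr r (under r {V}) = r" by blast
  then show ?thesis using poset_rank_eq[OF assms] by (simp add: poset_rank_def)
qed

text \<open>A connected symmetric graph is its own only component. Conversely, a component on all of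
  \<open>V\<close> is an induced subgraph with the full vertex set and hence equals
  \<open>F\<close>.\<close>

lemma ID_trees_eq:
  assumes "V \<noteq> {}"
  shows "ID_trees V = {F \<in> ID_forests V. verts ` components_of F = {V}}"
proof (intro set_eqI iffI)
  fix F assume "F \<in> ID_trees V"
  then have F: "pverts F = V" "ID_tree (with_proj F)" by (auto simp: ID_trees_def)
  then have uf: "undirected_forest (with_proj F)" and conn: "Digraph_Component.connected (with_proj F)"
    by (auto simp: ID_tree_def undirected_tree_def)
  interpret pair_graph F using uf by (intro pair_graphI_graph) (simp add: undirected_forest_def)
  have "strongly_connected (with_proj F)"
    using sym_arcs conn by (rule symmetric_connected_imp_strongly_connected)
  then have "components_of F = {with_proj F}"
    by (simp add: components_of_def strongly_connected_eq_iff)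
  then show "F \<in> {F \<in> ID_forests V. verts ` components_of F = {V}}"
    using F uf by (simp add: ID_forests_def)
next
  fix F assume "F \<in> {F \<in> ID_forests V. verts ` components_of F = {V}}"
  then have F: "pverts F = V" "\<And>T. T \<in> components_of F \<Longrightarrow> ID_tree T" "F \<in> ID_forests V"
    "verts ` components_of F = {V}" by (auto simp: ID_forests_def)
  have "V \<in> verts ` components_of F" unfolding F(4) by simp
  then obtain T where T: "T \<in> components_of F" "verts T = V" by (rule imageE) simp
  interpret nbc_graph V F
    using F(3) V ID_forests_imp_nbc by (simp add: nbc_graph_def)
  have "induced_subgraph T (with_proj F)"
    using T(1) unfolding components_of_def by (rule in_sccs_imp_induced)
  then have "T = with_proj F"
    using induced_subgraph_refl by (rule induced_eq_verts_imp_eq) (simp add: T(2))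
  then show "F \<in> ID_trees V" using F T by (simp add: ID_trees_def)
qed

lemma card_ID_forests_card:
  "int (card (ID_forests_card V k)) = (\<Sum>\<pi> | \<pi> \<in> bonds (Gamma V) \<and> card \<pi> = k. int (N \<pi>))"
proof -
  let ?P = "{\<pi>. \<pi> \<in> bonds (Gamma V) \<and> card \<pi> = k}"
  have "ID_forests_card V k = {F. nbc V F \<and> comps V (parcs F) \<in> ?P}"
    using comps_in_bonds[OF V(1)] nbc_components(2)
    by (auto simp: ID_forests_card_def ID_forests_eq[OF V])
  then show ?thesis
    using sum_N[of ?P "\<lambda>_. 1"] finite_bonds by simp
qed

lemma neg_one_power_monom: "(-1) ^ n * monom (c :: int) k = monom ((-1) ^ n * c) k"
  by (cases "even n") (simp_all add: minus_monom)

text \<open>The exponent at a bond depends only on its number of blocks, so the bonds are grouped by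
  that number and \<open>card_ID_forests_card\<close> evaluates each group.\<close>

lemma characteristic_poly_eq:
  assumes "{V} \<in> bonds (Gamma V)"
  shows "characteristic_poly r =
    (-1) ^ card V * (\<Sum>k = 1..card V. monom ((-1) ^ k * int (card (ID_forests_card V k))) (k - 1))"
proof -
  have range: "1 \<le> card \<pi>" "card \<pi> \<le> card V" if "\<pi> \<in> bonds (Gamma V)" for \<pi>
  proof -
    show "card \<pi> \<le> card V" using that by (rule card_bond_le)
    show "1 \<le> card \<pi>"
      using top_greatest[OF assms that] refines_card(1)[OF V(1), of \<pi> "{V}"] by (simp add: r_iff)
  qed
  define h where "h \<pi> = monom ((-1) ^ card V * ((-1) ^ card \<pi> * int (N \<pi>))) (card \<pi> - 1)" for \<pi>
  have "characteristic_poly r = (\<Sum>\<pi>\<in>bonds (Gamma V). h \<pi>)"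
    unfolding characteristic_poly_def Field_r
  proof (rule sum.cong[OF refl])
    fix \<pi> assume \<pi>: "\<pi> \<in> bonds (Gamma V)"
    \<comment> \<open>Subtraction is truncated, so both bounds in \<open>range\<close> are needed
      here.\<close>
    have "card V - 1 - (card V - card \<pi>) = card \<pi> - 1" using range[OF \<pi>] by linarith
    then show "monom (moebius r (poset_bot r) \<pi>) (poset_length r - poset_rank r \<pi>) = h \<pi>"
      using \<pi> by (simp add: moebius_bot poset_rank_eq poset_length_eq[OF assms] h_def)
  qed
  also have "\<dots> = (\<Sum>k = 1..card V. \<Sum>\<pi> | \<pi> \<in> bonds (Gamma V) \<and> card \<pi> = k. h \<pi>)"
    using finite_bonds range by (intro sum.group[symmetric]) auto
  also have "\<dots> = (\<Sum>k = 1..card V. (-1) ^ card V * monom ((-1) ^ k * int (card (ID_forests_card V k))) (k - 1))"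
  proof (rule sum.cong[OF refl])
    fix k
    have "(\<Sum>\<pi> | \<pi> \<in> bonds (Gamma V) \<and> card \<pi> = k. h \<pi>) =
        (\<Sum>\<pi> | \<pi> \<in> bonds (Gamma V) \<and> card \<pi> = k. monom ((-1) ^ card V * ((-1) ^ k * int (N \<pi>))) (k - 1))"
      by (rule sum.cong) (auto simp: h_def)
    then show "(\<Sum>\<pi> | \<pi> \<in> bonds (Gamma V) \<and> card \<pi> = k. h \<pi>) =
        (-1) ^ card V * monom ((-1) ^ k * int (card (ID_forests_card V k))) (k - 1)"
      by (simp add: card_ID_forests_card sum_distrib_left monom_sum neg_one_power_monom)
  qed
  finally show ?thesis by (simp add: sum_distrib_left)
qed

end

text \<open>The factor \<open>(-1) ^ card V\<close> is forced by the bottom, where the Moebius value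
  and the count are 1 and there are \<open>card V\<close> blocks. Connectedness makes
  \<open>{V}\<close> the top; otherwise the top is the partition into the components of
  \<open>Gamma V\<close>, whose forests are not trees on \<open>V\<close>.\<close>

theorem theorem3p5:
  fixes V :: "nat set"
  assumes "finite V" and "0 \<notin> V"
  shows
    "(\<forall>\<pi> \<in> bonds (Gamma V).
        (-1) ^ card V * ((-1) ^ card \<pi> *
          moebius (bond_lattice (Gamma V)) (poset_bot (bond_lattice (Gamma V))) \<pi>)
        = int (card {F \<in> ID_forests V. verts ` components_of F = \<pi>})) \<and>
     (Digraph_Component.connected (with_proj (Gamma V)) \<longrightarrow>
        (-1) ^ card V *
          (- moebius (bond_lattice (Gamma V)) (poset_bot (bond_lattice (Gamma V)))
               (poset_top (bond_lattice (Gamma V))))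
        = int (card (ID_trees V)) \<and>
        characteristic_poly (bond_lattice (Gamma V))
        = (-1) ^ card V *
          (\<Sum>k = 1..card V. monom ((-1) ^ k * int (card (ID_forests_card V k))) (k - 1)))"
proof -
  interpret Gamma_bonds V using assms by unfold_locales
  have first: "(-1) ^ card V * ((-1) ^ card \<pi> * moebius r (poset_bot r) \<pi>) =
      int (card {F \<in> ID_forests V. verts ` components_of F = \<pi>})" if "\<pi> \<in> bonds (Gamma V)" for \<pi>
  proof -
    have "(-1) ^ card V * ((-1) ^ card \<pi> * moebius r (poset_bot r) \<pi>) =
        ((-1) ^ card V * (-1) ^ card V) * ((-1) ^ card \<pi> * (-1) ^ card \<pi>) * int (N \<pi>)"
      by (simp only: moebius_bot[OF that] ac_simps)
    then show ?thesis by (simp add: N_def flip: power_mult_distrib)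
  qed
  moreover have "(-1) ^ card V * (- moebius r (poset_bot r) (poset_top r)) = int (card (ID_trees V))"
    and "characteristic_poly r =
      (-1) ^ card V * (\<Sum>k = 1..card V. monom ((-1) ^ k * int (card (ID_forests_card V k))) (k - 1))"
    if "Digraph_Component.connected (with_proj (Gamma V))"
    using first[OF connected_imp_top_bond(1)[OF that]] ID_trees_eq[OF connected_imp_top_bond(2)[OF that]]
      poset_top_eq[OF connected_imp_top_bond(1)[OF that]]
      characteristic_poly_eq[OF connected_imp_top_bond(1)[OF that]]
    by simp_all
  ultimately show ?thesis by blast
qed

end
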